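(* Let $\kappa\geq\mathfrak{c}$ be a cardinal number and let $X$ be a Banach space with $w^*\text{-}\mathrm{dens}\, X^*>\exp_2\kappa$. Then $X$ contains a subspace $Y$ with an Auerbach basis and such that $\mathrm{dens}\, Y=\kappa^+$.
   Context: Banach spaces are over the real or the complex field; subspaces are closed. $\mathfrak{c}$ is the cardinality of the continuum, $\kappa^+$ is the successor cardinal of $\kappa$, $\exp_1\kappa=2^\kappa$ and $\exp_{n+1}\kappa=2^{\exp_n\kappa}$. $\mathrm{dens}$ is the density character and $w^*\text{-}\mathrm{dens}\,X^*$ is the density character of $X^*$ in the $w^*$-topology. An M-basis of $Y$ is a family $\{x_\gamma;x_\gamma^*\}_{\gamma\in\Gamma}\subseteq Y\times Y^*$ with $\langle x_\alpha^*,x_\beta\rangle=\delta_{\alpha,\beta}$, with $\{x_\gamma\}$ having norm-dense linear span in $Y$ and $\{x_\gamma^*\}$ having $w^*$-dense linear span in $Y^*$. An Auerbach basis of $Y$ is an M-basis with $\|x_\gamma\|=\|x^*_\gamma\|=1$ for every $\gamma\in\Gamma$. *)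

theory Defs
  imports "HOL-Analysis.Analysis"
begin

unbundle cardinal_syntax

section \<open>Density character\<close>

definition dense_subset :: "'a topology \<Rightarrow> 'a set \<Rightarrow> bool" where
  "dense_subset T D \<longleftrightarrow> D \<subseteq> topspace T \<and> T closure_of D = topspace T"

definition dens :: "'a topology \<Rightarrow> 'a rel" where
  "dens T = |SOME D. dense_subset T D \<and> (\<forall>E. dense_subset T E \<longrightarrow> |D| \<le>o |E| )|"

lemma dens_attained:
  "\<exists>D. dense_subset T D \<and> dens T = |D| \<and> (\<forall>E. dense_subset T E \<longrightarrow> |D| \<le>o |E| )"
proof -
  let ?R = "{ |D| | D. dense_subset T D}"
  have "dense_subset T (topspace T)"
    by (simp add: dense_subset_def)
  then have "?R \<noteq> {}" by blast
  moreover have "\<forall>r\<in>?R. Card_order r" by (auto simp: card_of_Card_order)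
  ultimately obtain r where "r \<in> ?R" "\<forall>r'\<in>?R. r \<le>o r'"
    using exists_minim_Card_order[of ?R] by blast
  then have "\<exists>D. dense_subset T D \<and> (\<forall>E. dense_subset T E \<longrightarrow> |D| \<le>o |E| )" by blast
  note D = someI_ex[OF this]
  show ?thesis
    by (intro exI conjI) (fact conjunct1[OF D], fact dens_def, fact conjunct2[OF D])
qed

section \<open>Normed spaces over a scalar field\<close>

text \<open>
  The library has no class of complex normed spaces. A complex Banach space is rendered
  as a (real) Banach space carrying in addition a complex scalar multiplication that extends the
  real one and for which the norm is absolutely homogeneous. The notions below are stated for an
  arbitrary scalar multiplication, and are meant for the scalar fields \<open>real\<close> and \<open>complex\<close>.
\<close>

definition normed_space_over ::
    "('k::real_normed_field \<Rightarrow> 'a::real_normed_vector \<Rightarrow> 'a) \<Rightarrow> bool" where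
  "normed_space_over sc \<longleftrightarrow>
     vector_space sc \<and>
     (\<forall>r x. sc (of_real r) x = r *\<^sub>R x) \<and>
     (\<forall>c x. norm (sc c x) = norm c * norm x)"

lemma normed_space_over_real_iff:
  "normed_space_over (sc :: real \<Rightarrow> 'a::real_normed_vector \<Rightarrow> 'a) \<longleftrightarrow> sc = scaleR"
proof
  assume "normed_space_over sc"
  then show "sc = scaleR" by (simp add: normed_space_over_def fun_eq_iff)
next
  assume "sc = scaleR"
  then show "normed_space_over sc"
    using real_vector.vector_space_axioms by (simp add: normed_space_over_def)
qed

lemma normed_space_over_complex: "normed_space_over ((*) :: complex \<Rightarrow> complex \<Rightarrow> complex)"
  unfolding normed_space_over_def
  by (auto simp: vector_space_def algebra_simps norm_mult scaleR_conv_of_real)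

definition closed_subspace ::
    "('k::real_normed_field \<Rightarrow> 'a::real_normed_vector \<Rightarrow> 'a) \<Rightarrow> 'a set \<Rightarrow> bool" where
  "closed_subspace sc Y \<longleftrightarrow> module.subspace sc Y \<and> closed Y"

text \<open>
  Functionals on a subspace \<open>Y\<close> are represented by functions on the ambient space that are
  \<open>undefined\<close> outside \<open>Y\<close>, so that equality of functionals is equality on \<open>Y\<close>.
\<close>

definition dual ::
    "('k::real_normed_field \<Rightarrow> 'a::real_normed_vector \<Rightarrow> 'a) \<Rightarrow> 'a set \<Rightarrow> ('a \<Rightarrow> 'k) set" where
  "dual sc Y = {f \<in> extensional Y.
     (\<forall>x\<in>Y. \<forall>y\<in>Y. f (x + y) = f x + f y) \<and>
     (\<forall>c. \<forall>x\<in>Y. f (sc c x) = c * f x) \<and>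
     (\<exists>B. \<forall>x\<in>Y. norm (f x) \<le> B * norm x)}"

definition dual_norm :: "'a::real_normed_vector set \<Rightarrow> ('a \<Rightarrow> 'k::real_normed_field) \<Rightarrow> real" where
  "dual_norm Y f = (SUP x\<in>{x \<in> Y. norm x \<le> 1}. norm (f x))"

text \<open>The weak-star topology is the topology of pointwise convergence on \<open>Y\<close>.\<close>

definition weak_star ::
    "('k::real_normed_field \<Rightarrow> 'a::real_normed_vector \<Rightarrow> 'a) \<Rightarrow> 'a set \<Rightarrow> ('a \<Rightarrow> 'k) topology" where
  "weak_star sc Y = subtopology (product_topology (\<lambda>_. euclidean) Y) (dual sc Y)"

lemma topspace_weak_star [simp]: "topspace (weak_star sc Y) = dual sc Y"
  by (auto simp: weak_star_def dual_def PiE_def)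

definition dual_span :: "'a set \<Rightarrow> ('a \<Rightarrow> 'k::field) set \<Rightarrow> ('a \<Rightarrow> 'k) set" where
  "dual_span Y F = {\<lambda>y\<in>Y. \<Sum>f\<in>A. c f * f y | A c. finite A \<and> A \<subseteq> F}"

section \<open>M-bases and Auerbach bases\<close>

definition M_basis ::
    "('k::real_normed_field \<Rightarrow> 'a::real_normed_vector \<Rightarrow> 'a) \<Rightarrow> 'a set \<Rightarrow>
     'i set \<Rightarrow> ('i \<Rightarrow> 'a) \<Rightarrow> ('i \<Rightarrow> 'a \<Rightarrow> 'k) \<Rightarrow> bool" where
  "M_basis sc Y \<Gamma> x xs \<longleftrightarrow>
     (\<forall>\<gamma>\<in>\<Gamma>. x \<gamma> \<in> Y \<and> xs \<gamma> \<in> dual sc Y) \<and>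
     (\<forall>\<alpha>\<in>\<Gamma>. \<forall>\<beta>\<in>\<Gamma>. xs \<alpha> (x \<beta>) = (if \<alpha> = \<beta> then 1 else 0)) \<and>
     dense_subset (top_of_set Y) (module.span sc (x ` \<Gamma>)) \<and>
     dense_subset (weak_star sc Y) (dual_span Y (xs ` \<Gamma>))"

definition Auerbach_basis ::
    "('k::real_normed_field \<Rightarrow> 'a::real_normed_vector \<Rightarrow> 'a) \<Rightarrow> 'a set \<Rightarrow>
     'i set \<Rightarrow> ('i \<Rightarrow> 'a) \<Rightarrow> ('i \<Rightarrow> 'a \<Rightarrow> 'k) \<Rightarrow> bool" where
  "Auerbach_basis sc Y \<Gamma> x xs \<longleftrightarrow>
     M_basis sc Y \<Gamma> x xs \<and> (\<forall>\<gamma>\<in>\<Gamma>. norm (x \<gamma>) = 1 \<and> dual_norm Y (xs \<gamma>) = 1)"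

text \<open>
  Biorthogonality makes \<open>x\<close> injective on \<open>\<Gamma>\<close>, so there is no loss of generality in taking the
  indices from the type of the vectors themselves.
\<close>

definition has_Auerbach_basis ::
    "('k::real_normed_field \<Rightarrow> 'a::real_normed_vector \<Rightarrow> 'a) \<Rightarrow> 'a set \<Rightarrow> bool" where
  "has_Auerbach_basis sc Y \<longleftrightarrow> (\<exists>(\<Gamma> :: 'a set) x xs. Auerbach_basis sc Y \<Gamma> x xs)"

end

theory Submission
  imports Defs
begin

text \<open>
  Fix for every vector \<open>z\<close> a functional \<open>N z\<close> of norm at most one with \<open>N z z = \<parallel>z\<parallel>\<close>. A family of at
  most \<open>exp\<^sub>2 \<kappa>\<close> functionals cannot separate the points of \<open>X\<close>, since otherwise its span, which is no
  larger, would be weak-star dense in the dual. Hence one can keep choosing nonzero vectors \<open>e\<close> in the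
  common kernel of the norming functionals of everything spanned so far. In a long sequence chosen in
  this way \<open>N z\<close> annihilates all vectors later than \<open>z\<close>, and one has to make it vanish also on earlier
  ones.

  This is achieved by colouring. The value of \<open>N (e j - e k)\<close> at \<open>e i\<close>, for \<open>i < j < k\<close>, is a colour of
  triples, with at most continuum many colours. Two stepping-up arguments in the style of Erdos and Rado
  and a pigeonhole argument (\<open>end_homogeneous_sequence\<close>, \<open>exists_homogeneous_vectors\<close>,
  \<open>exists_paired_indices\<close>) leave \<open>\<kappa>\<^sup>+\<close> vectors on which all these values are equal. Now pair up the
  vectors: the functional of a difference \<open>e j - e k\<close> takes equal values at the two members of every
  earlier pair, hence vanishes at earlier differences, and it vanishes at later vectors anyway. The
  normalised differences with their norming functionals are therefore biorthogonal with all norms equal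
  to one (\<open>exists_monotone_Auerbach_system\<close>).

  It remains to see that the functionals separate the points of the closed span \<open>Y\<close>, which by
  \<open>total_imp_weak_star_dense\<close> gives an M-basis. This holds because the vectors form a long monotone basic
  sequence (\<open>coordinates_total\<close>). The density character of \<open>Y\<close> is \<open>\<kappa>\<^sup>+\<close> since the basis vectors are
  separated by distance one and \<open>\<kappa>\<close> bounds the number of scalars.

  The argument is the same over both scalar fields; they differ only in the existence of norming
  functionals, that is, in the Hahn-Banach theorem.
\<close>

section \<open>Cardinal arithmetic and end-homogeneous sequences\<close>

lemma card_of_lists_ordLeq:
  assumes "Cinfinite r" and A: "|A| \<le>o r"
  shows "|lists A| \<le>o r"
proof -
  have len: "|{xs \<in> lists A. length xs = n}| \<le>o r" for n
  proof (induction n)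
    case 0
    have "{xs \<in> lists A. length xs = 0} = {[]}" by auto
    moreover have "|{[]}| \<le>o r"
      using assms(1) by (intro Card_order_singl_ordLeq) (auto simp: cinfinite_def)
    ultimately show ?case by simp
  next
    case (Suc n)
    let ?L = "{xs \<in> lists A. length xs = n}"
    have "{xs \<in> lists A. length xs = Suc n} \<subseteq> (\<lambda>(x, xs). x # xs) ` (A \<times> ?L)"
      by (force simp: length_Suc_conv)
    then have "|{xs \<in> lists A. length xs = Suc n}| \<le>o |A \<times> ?L|"
      by (rule surj_imp_ordLeq)
    also have "|A \<times> ?L| \<le>o r"
      using assms Suc by (intro card_of_Times_ordLeq_infinite_Field) (auto simp: cinfinite_def)
    finally show ?case .
  qed
  have "lists A = (\<Union>n. {xs \<in> lists A. length xs = n})" by auto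
  moreover have "|UNIV :: nat set| \<le>o r"
    using natLeq_ordLeq_cinfinite[OF assms(1)] card_of_nat ordIso_ordLeq_trans by blast
  ultimately show ?thesis
    using UNION_Cinfinite_bound[of UNIV r "\<lambda>n. {xs \<in> lists A. length xs = n}"] len assms(1) by simp
qed

lemma cardSuc_under_ordLeq:
  assumes "Cinfinite \<mu>" "a \<in> Field (cardSuc \<mu>)"
  shows "|underS (cardSuc \<mu>) a| \<le>o \<mu>" "|under (cardSuc \<mu>) a| \<le>o \<mu>"
proof -
  have "|underS (cardSuc \<mu>) a| <o cardSuc \<mu>"
    using assms by (intro card_of_underS cardSuc_Card_order) auto
  then show *: "|underS (cardSuc \<mu>) a| \<le>o \<mu>"
    using cardSuc_ordLeq_ordLess[of \<mu> "|underS (cardSuc \<mu>) a|"] assms by (simp add: card_of_Card_order)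
  have "|{a}| \<le>o \<mu>"
    using assms by (intro Card_order_singl_ordLeq) (auto simp: cinfinite_def)
  then have "|underS (cardSuc \<mu>) a \<union> {a}| \<le>o \<mu>"
    using * assms by (intro Un_Cinfinite_bound)
  moreover have "under (cardSuc \<mu>) a \<subseteq> underS (cardSuc \<mu>) a \<union> {a}"
    by (auto simp: under_def underS_def)
  ultimately show "|under (cardSuc \<mu>) a| \<le>o \<mu>"
    by (meson card_of_mono1 ordLeq_transitive)
qed

text \<open>
  The strict upper bounds of a set are exactly what remains after deleting the \<open>|A|\<close> many initial
  segments below its members. Each of these has size at most \<open>\<mu>\<close>, so the deleted part is small and
  a large \<open>T\<close> is not exhausted.
\<close>

lemma large_subset_cardSuc_unbounded:
  assumes \<mu>: "Cinfinite \<mu>" and T: "T \<subseteq> Field (cardSuc \<mu>)" "\<not> |T| \<le>o \<mu>"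
    and A: "A \<subseteq> Field (cardSuc \<mu>)" "|A| \<le>o \<mu>"
  shows "\<exists>t\<in>T. A \<subseteq> underS (cardSuc \<mu>) t"
proof -
  let ?r = "cardSuc \<mu>"
  have wo: "Well_order ?r" using \<mu> cardSuc_Well_order by blast
  have "|\<Union>a\<in>A. under ?r a| \<le>o \<mu>"
    using A cardSuc_under_ordLeq(2)[OF \<mu>] \<mu> by (intro UNION_Cinfinite_bound) auto
  then have "\<not> T \<subseteq> (\<Union>a\<in>A. under ?r a)"
    using T(2) card_of_mono1 ordLeq_transitive by blast
  then obtain t where t: "t \<in> T" "\<forall>a\<in>A. (t, a) \<notin> ?r" by (auto simp: under_def)
  have "a \<in> underS ?r t" if "a \<in> A" for a
  proof -
    have "a \<in> Field ?r" "t \<in> Field ?r" using that t A T by auto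
    then have "(a, t) \<in> ?r" "a \<noteq> t"
      using wo t(2) that
      unfolding well_order_on_def linear_order_on_def partial_order_on_def preorder_on_def
        total_on_def refl_on_def by metis+
    then show ?thesis by (simp add: underS_def)
  qed
  with t show ?thesis by blast
qed

lemma cardSuc_not_ordLeq:
  assumes "Card_order \<mu>" shows "\<not> |Field (cardSuc \<mu>)| \<le>o \<mu>"
proof
  assume "|Field (cardSuc \<mu>)| \<le>o \<mu>"
  moreover have "cardSuc \<mu> =o |Field (cardSuc \<mu>)|"
    using assms card_of_Field_ordIso cardSuc_Card_order ordIso_symmetric by blast
  ultimately have "cardSuc \<mu> \<le>o \<mu>" by (metis ordIso_ordLeq_trans)
  then show False using cardSuc_greater[OF assms] not_ordLess_ordLeq by blast
qed

lemma well_order_recursive_choice: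
  assumes "Well_order r" and "\<And>i f. i \<in> Field r \<Longrightarrow> (\<And>j. j \<in> underS r i \<Longrightarrow> P f j (f j)) \<Longrightarrow> \<exists>x. P f i x"
    and "\<And>f g i x. (\<And>j. j \<in> underS r i \<Longrightarrow> f j = g j) \<Longrightarrow> P f i x = P g i x"
  shows "\<exists>f. \<forall>i\<in>Field r. P f i (f i)"
proof -
  have wf: "wf (r - Id)" using assms(1) by (simp add: well_order_on_def)
  have *: "(j, i) \<in> r - Id \<longleftrightarrow> j \<in> underS r i" for i j by (auto simp: underS_def)
  from wf have "\<exists>f. \<forall>i. i \<in> Field r \<longrightarrow> P f i (f i)"
  proof (rule dependent_wf_choice[where P = "\<lambda>f i x. i \<in> Field r \<longrightarrow> P f i x"], goal_cases)
    case (1 f g i x)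
    then show ?case using assms(3)[of i f g x] * by auto
  next
    case (2 i f)
    show ?case
    proof (cases "i \<in> Field r")
      case True
      have "j \<in> Field r" if "j \<in> underS r i" for j using that by (auto simp: underS_def Field_def)
      then show ?thesis using 2 assms(2)[OF True, of f] * by blast
    qed auto
  qed
  then show ?thesis by blast
qed

text \<open>
  This is the stepping-up step of the Erdos-Rado theorem; the order in question is that of the
  sequence \<open>e\<close>. Every \<open>x\<close> generates a branch of a tree by recursion: the next node
  \<open>s x i\<close> is an element that satisfies \<open>R\<close> over the earlier nodes and has the same colours over them
  as \<open>x\<close>. The choice is made from the colours alone, so the \<open>i\<close>-th node depends only on the table of
  colours met so far, and the tree has at most \<open>\<mu>\<^sup>+ \<cdot> (2\<^sup>\<mu>)\<^sup>\<mu> = 2\<^sup>\<mu>\<close> nodes. By hypothesis some \<open>x\<close>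
  satisfies \<open>R\<close> over the whole tree. The branch of this \<open>x\<close> never gets stuck, since \<open>x\<close> itself is
  always a witness for the next choice, and it is the required sequence.
\<close>

lemma end_homogeneous_sequence:
  fixes S :: "'s set" and c :: "'s \<Rightarrow> 's \<Rightarrow> 's \<Rightarrow> 'c" and \<mu> :: "'m rel"
  assumes \<mu>: "Cinfinite \<mu>" and col: "|UNIV :: 'c set| \<le>o ctwo ^c \<mu>"
    and anti: "\<And>A B x. B \<subseteq> A \<Longrightarrow> R A x \<Longrightarrow> R B x"
    and big: "\<And>A. A \<subseteq> S \<Longrightarrow> |A| \<le>o ctwo ^c \<mu> \<Longrightarrow> \<exists>x\<in>S. R A x"
  obtains e h where "\<And>i. i \<in> Field (cardSuc \<mu>) \<Longrightarrow> e i \<in> S"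
    and "\<And>i. i \<in> Field (cardSuc \<mu>) \<Longrightarrow> R (e ` underS (cardSuc \<mu>) i) (e i)"
    and "\<And>i j k. i \<in> underS (cardSuc \<mu>) k \<Longrightarrow> j \<in> underS (cardSuc \<mu>) k \<Longrightarrow>
           c (e i) (e j) (e k) = h i j"
proof -
  let ?r = "cardSuc \<mu>"
  let ?F = "Field ?r"
  have wo: "Well_order ?r" using \<mu> cardSuc_Well_order by blast
  have inf2: "Cinfinite (ctwo ^c \<mu>)" 
    by (rule Cinfinite_cexp[OF ordLeq_refl[OF Card_order_ctwo] \<mu>])
  define good where "good x B a \<longleftrightarrow> a \<in> S \<and> R B a \<and> (\<forall>b\<in>B. \<forall>b'\<in>B. c b b' a = c b b' x)" for x B a
  define pick where "pick x B = (SOME a. good x B a)" for x B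
  have "\<exists>f. \<forall>i\<in>?F. f i = pick x (f ` underS ?r i)" for x
    using wo by (rule well_order_recursive_choice[where P = "\<lambda>f i a. a = pick x (f ` underS ?r i)"])
       (auto intro!: arg_cong[where f = "pick x"] image_cong)
  then obtain s where s: "\<And>x i. i \<in> ?F \<Longrightarrow> s x i = pick x (s x ` underS ?r i)" by metis
  have wf: "wf (?r - Id)" using wo by (simp add: well_order_on_def)
  have under_F: "underS ?r i \<subseteq> ?F" for i by (auto simp: underS_def Field_def)
  \<comment> \<open>The colour table is indexed by the closed segment below \<open>i\<close>, with a dummy value where \<open>i\<close> itself
    occurs: a nonempty index set is what makes exponentiation monotone in the exponent.\<close>
  define \<phi> where "\<phi> i x = (\<lambda>p\<in>under ?r i \<times> under ?r i.
    if p \<in> underS ?r i \<times> underS ?r i then c (s x (fst p)) (s x (snd p)) x else undefined)" for i x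
  have \<phi>_eq: "c (s x k) (s x l) x = c (s y k) (s y l) y"
    if "\<phi> i x = \<phi> i y" "k \<in> underS ?r i" "l \<in> underS ?r i" for i x y k l
    using fun_cong[OF that(1), of "(k, l)"] that underS_subset_under[of ?r i]
    by (auto simp: \<phi>_def subset_iff)
  have trans: "trans ?r" using wo unfolding order_on_defs by blast
  have anti_r: "antisym ?r" using wo unfolding order_on_defs by blast
  have sub_under: "underS ?r k \<subseteq> underS ?r i" if "k \<in> underS ?r i" for k i
    using that underS_incr[OF trans anti_r, of k i] by (simp add: underS_def)
  have determined: "s x i = s y i" if "\<phi> i x = \<phi> i y" "i \<in> ?F" for x y i
    using that
  proof (induction i rule: wf_induct_rule[OF wf])
    case (1 i)
    have "s x k = s y k" if k: "k \<in> underS ?r i" for k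
    proof (rule 1(1))
      show "(k, i) \<in> ?r - Id" using k by (auto simp: underS_def)
      show "k \<in> ?F" using k under_F by auto
      show "\<phi> k x = \<phi> k y"
        unfolding \<phi>_def using \<phi>_eq[OF 1(2) subsetD[OF sub_under[OF k]] subsetD[OF sub_under[OF k]]]
        by (intro restrict_ext) (simp add: mem_Times_iff)
    qed
    then have B: "s x ` underS ?r i = s y ` underS ?r i" by (auto intro!: image_cong)
    have "good x (s x ` underS ?r i) a = good y (s x ` underS ?r i) a" for a
    proof -
      have "c (s x k) (s x l) x = c (s x k) (s x l) y"
        if "k \<in> underS ?r i" "l \<in> underS ?r i" for k l
        using \<phi>_eq[OF 1(2) that] that \<open>\<And>k. k \<in> underS ?r i \<Longrightarrow> s x k = s y k\<close> by simp
      then show ?thesis by (auto simp: good_def)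
    qed
    then have "pick x (s x ` underS ?r i) = pick y (s y ` underS ?r i)"
      unfolding pick_def B by presburger
    then show ?case using s 1(3) by metis
  qed
  \<comment> \<open>The nodes of the tree. Branches that got stuck may leave \<open>S\<close>, hence the intersection.\<close>
  define A where "A = (\<Union>i\<in>?F. (\<lambda>x. s x i) ` UNIV) \<inter> S"
  have "|(\<lambda>x. s x i) ` UNIV| \<le>o ctwo ^c \<mu>" if i: "i \<in> ?F" for i
  proof -
    let ?U = "under ?r i \<times> under ?r i"
    have "(\<lambda>x. s x i) ` UNIV \<subseteq> (\<lambda>f. s (inv_into UNIV (\<phi> i) f) i) ` (\<phi> i ` UNIV)"
    proof (clarsimp simp: image_iff)
      fix x
      have "\<phi> i (inv_into UNIV (\<phi> i) (\<phi> i x)) = \<phi> i x" by (simp add: f_inv_into_f)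
      then show "\<exists>xa. s x i = s (inv (\<phi> i) (\<phi> i xa)) i" using determined i by metis
    qed
    then have "|(\<lambda>x. s x i) ` UNIV| \<le>o |\<phi> i ` UNIV|" by (rule surj_imp_ordLeq)
    also have "|\<phi> i ` UNIV| \<le>o |Func ?U (UNIV :: 'c set)|"
      by (intro card_of_mono1) (auto simp: \<phi>_def Func_def)
    also have "|Func ?U (UNIV :: 'c set)| =o |UNIV :: 'c set| ^c |?U|"
      by (simp add: cexp_def Field_card_of card_of_refl)
    also have "|UNIV :: 'c set| ^c |?U| \<le>o (ctwo ^c \<mu>) ^c \<mu>"
    proof (rule cexp_mono'[OF col])
      show "|?U| \<le>o \<mu>"
        using \<mu> cardSuc_under_ordLeq(2)[OF \<mu> i]
        by (intro card_of_Times_ordLeq_infinite_Field) (auto simp: cinfinite_def)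
      show "Field |?U| = {} \<Longrightarrow> Field \<mu> = {}"
        using i wo by (auto simp: Field_card_of under_def order_on_defs refl_on_def)
    qed
    also have "(ctwo ^c \<mu>) ^c \<mu> =o ctwo ^c \<mu>"
      using \<mu> by (intro cexp_cprod_ordLeq) (auto simp: Card_order_ctwo Cinfinite_Cnotzero ordLeq_refl)
    finally show ?thesis .
  qed
  moreover have "|?F| \<le>o ctwo ^c \<mu>"
  proof -
    have "|?F| =o ?r" using \<mu> card_of_Field_ordIso cardSuc_Card_order by blast
    also have "?r \<le>o ctwo ^c \<mu>"
      using \<mu> by (intro cardSuc_least ordLess_ctwo_cexp Card_order_cexp) auto
    finally show ?thesis .
  qed
  ultimately have "|\<Union>i\<in>?F. (\<lambda>x. s x i) ` UNIV| \<le>o ctwo ^c \<mu>"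
    using inf2 by (intro UNION_Cinfinite_bound) auto
  then have "|A| \<le>o ctwo ^c \<mu>"
    unfolding A_def by (meson card_of_mono1 inf_le1 ordLeq_transitive)
  then obtain x where x: "x \<in> S" "R A x" using big[of A] by (auto simp: A_def)
  have good: "good x (s x ` underS ?r i) (s x i)" if "i \<in> ?F" for i
    using that
  proof (induction i rule: wf_induct_rule[OF wf])
    case (1 i)
    have "s x k \<in> A" if k: "k \<in> underS ?r i" for k
    proof -
      have "k \<in> ?F" "(k, i) \<in> ?r - Id" using k under_F by (auto simp: underS_def)
      then have "s x k \<in> S" using 1(1)[of k] unfolding good_def by blast
      then show ?thesis using \<open>k \<in> ?F\<close> unfolding A_def by blast
    qed
    then have "good x (s x ` underS ?r i) x" using x by (auto simp: good_def intro!: anti[OF _ x(2)])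
    then have "good x (s x ` underS ?r i) (pick x (s x ` underS ?r i))"
      unfolding pick_def by (rule someI)
    then show ?case using s[OF 1(2), of x] by simp
  qed
  show thesis
  proof (rule that[of "s x" "\<lambda>i j. c (s x i) (s x j) x"])
    fix i j k assume "i \<in> underS ?r k" "j \<in> underS ?r k"
    moreover from this have "k \<in> ?F" by (auto simp: underS_def Field_def)
    ultimately show "c (s x i) (s x j) (s x k) = c (s x i) (s x j) x"
      using good[of k] by (auto simp: good_def)
  qed (use good in \<open>auto simp: good_def\<close>)
qed

section \<open>Norming functionals\<close>

definition sublinear :: "('a::real_vector \<Rightarrow> real) \<Rightarrow> bool" where
  "sublinear p \<longleftrightarrow> (\<forall>x y. p (x + y) \<le> p x + p y) \<and> (\<forall>t x. 0 \<le> t \<longrightarrow> p (t *\<^sub>R x) = t * p x)"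

lemma sublinearD:
  assumes "sublinear p"
  shows "p (x + y) \<le> p x + p y" "0 \<le> t \<Longrightarrow> p (t *\<^sub>R x) = t * p x" "p 0 = 0" "- p (- x) \<le> p x"
proof -
  show add: "p (x + y) \<le> p x + p y" for x y using assms by (simp add: sublinear_def)
  show scale: "0 \<le> t \<Longrightarrow> p (t *\<^sub>R x) = t * p x" for t x using assms by (simp add: sublinear_def)
  show 0: "p 0 = 0" using scale[of 0 0] by simp
  show "- p (- x) \<le> p x" using add[of x "- x"] 0 by simp
qed

text \<open>
  Among the sublinear functionals the linear ones are the pointwise minimal ones. The functional
  \<open>tilt p y\<close> is the greatest sublinear minorant of \<open>p\<close> whose value at \<open>- y\<close> is at most \<open>- p y\<close>. It
  serves twice: applied to a minimal \<open>p\<close> it gives \<open>p (- y) = - p y\<close>, and applied to the norm it forces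
  the minimal functional below it to be norming at a given vector.
\<close>

definition tilt :: "('a::real_vector \<Rightarrow> real) \<Rightarrow> 'a \<Rightarrow> 'a \<Rightarrow> real" where
  "tilt p y x = (INF t\<in>{0..}. p (x + t *\<^sub>R y) - t * p y)"

lemma tilt:
  assumes p: "sublinear p"
  shows "sublinear (tilt p y)" "tilt p y x \<le> p x" "tilt p y (- y) \<le> - p y"
proof -
  have bdd: "bdd_below ((\<lambda>t. p (x + t *\<^sub>R y) - t * p y) ` {0..})" for x
  proof (rule bdd_belowI2)
    fix t :: real assume "t \<in> {0..}"
    then have "t * p y = p (t *\<^sub>R y)" using sublinearD(2)[OF p] by simp
    also have "\<dots> \<le> p (x + t *\<^sub>R y) + p (- x)"
      using sublinearD(1)[OF p, of "x + t *\<^sub>R y" "- x"] by simp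
    finally show "- p (- x) \<le> p (x + t *\<^sub>R y) - t * p y" by simp
  qed
  have le: "tilt p y x \<le> p (x + t *\<^sub>R y) - t * p y" if "0 \<le> t" for x t
    unfolding tilt_def using that by (intro cINF_lower bdd) auto
  have ge: "a \<le> tilt p y x" if "\<And>t. 0 \<le> t \<Longrightarrow> a \<le> p (x + t *\<^sub>R y) - t * p y" for a x
    unfolding tilt_def using that by (intro cINF_greatest) auto
  show "tilt p y x \<le> p x" using le[of 0 x] by simp
  show "tilt p y (- y) \<le> - p y" using le[of 1 "- y"] sublinearD(3)[OF p] by simp
  have add: "tilt p y (u + v) \<le> tilt p y u + tilt p y v" for u v
  proof -
    have "tilt p y (u + v) - (p (v + t *\<^sub>R y) - t * p y) \<le> p (u + s *\<^sub>R y) - s * p y"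
      if "0 \<le> s" "0 \<le> t" for s t
    proof -
      have "tilt p y (u + v) \<le> p (u + v + (s + t) *\<^sub>R y) - (s + t) * p y"
        using that by (intro le) auto
      also have "p (u + v + (s + t) *\<^sub>R y) \<le> p (u + s *\<^sub>R y) + p (v + t *\<^sub>R y)"
        using sublinearD(1)[OF p, of "u + s *\<^sub>R y" "v + t *\<^sub>R y"] by (simp add: algebra_simps)
      finally show ?thesis by (simp add: algebra_simps)
    qed
    then have "tilt p y (u + v) - (p (v + t *\<^sub>R y) - t * p y) \<le> tilt p y u" if "0 \<le> t" for t
      using that by (intro ge) auto
    then have "tilt p y (u + v) - tilt p y u \<le> p (v + t *\<^sub>R y) - t * p y" if "0 \<le> t" for t
      using that by (force simp: algebra_simps)
    then have "tilt p y (u + v) - tilt p y u \<le> tilt p y v" by (intro ge) auto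
    then show ?thesis by simp
  qed
  have scale_le: "tilt p y (r *\<^sub>R u) \<le> r * tilt p y u" if r: "0 < r" for r u
  proof -
    have "tilt p y (r *\<^sub>R u) / r \<le> p (u + t *\<^sub>R y) - t * p y" if "0 \<le> t" for t
    proof -
      have "tilt p y (r *\<^sub>R u) \<le> p (r *\<^sub>R u + (r * t) *\<^sub>R y) - (r * t) * p y"
        using that r by (intro le) auto
      also have "p (r *\<^sub>R u + (r * t) *\<^sub>R y) = r * p (u + t *\<^sub>R y)"
        using sublinearD(2)[OF p, of r "u + t *\<^sub>R y"] r by (simp add: algebra_simps)
      finally show ?thesis using r by (simp add: field_simps)
    qed
    then have "tilt p y (r *\<^sub>R u) / r \<le> tilt p y u" by (rule ge)
    then show ?thesis using r by (simp add: field_simps)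
  qed
  have tilt0: "tilt p y 0 = 0"
  proof (rule antisym)
    show "tilt p y 0 \<le> 0" using le[of 0 0] sublinearD(3)[OF p] by simp
    show "0 \<le> tilt p y 0" using sublinearD(2)[OF p] by (intro ge) simp
  qed
  have "tilt p y (r *\<^sub>R u) = r * tilt p y u" if "0 \<le> r" for r u
  proof (cases "r = 0")
    case True then show ?thesis using tilt0 by simp
  next
    case False
    then have r: "0 < r" using that by simp
    have "tilt p y u \<le> inverse r * tilt p y (r *\<^sub>R u)"
      using scale_le[of "inverse r" "r *\<^sub>R u"] r by simp
    then have "r * tilt p y u \<le> tilt p y (r *\<^sub>R u)" using r by (simp add: field_simps)
    with scale_le[OF r, of u] show ?thesis by simp
  qed
  with add show "sublinear (tilt p y)" by (simp add: sublinear_def)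
qed

text \<open>
  Zorn's lemma applies since the pointwise infimum of a chain is sublinear; the infimum is finite
  because \<open>- q (- x)\<close> is a lower bound at \<open>x\<close> for all sublinear functionals below \<open>q\<close>.
\<close>

lemma minimal_sublinear_below:
  fixes q :: "'a::real_vector \<Rightarrow> real"
  assumes "sublinear q"
  obtains p where "sublinear p" "p \<le> q" "\<And>p'. sublinear p' \<Longrightarrow> p' \<le> p \<Longrightarrow> p' = p"
proof -
  define A where "A = {p. sublinear p \<and> p \<le> q}"
  have "\<exists>m\<in>A. \<forall>a\<in>A. a \<le> m \<longrightarrow> a = m"
  proof (rule predicate_Zorn)
    show "partial_order_on A (relation_of (\<lambda>a b. b \<le> a) A)"
      by (auto simp: partial_order_on_def preorder_on_def refl_on_def trans_def antisym_def relation_of_def)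
  next
    fix C assume "C \<in> Chains (relation_of (\<lambda>a b. b \<le> a) A)"
    then have C: "C \<subseteq> A" and chain: "\<And>a b. a \<in> C \<Longrightarrow> b \<in> C \<Longrightarrow> a \<le> b \<or> b \<le> a"
      unfolding Chains_def relation_of_def by auto
    show "\<exists>u\<in>A. \<forall>a\<in>C. u \<le> a"
    proof (cases "C = {}")
      case True
      then show ?thesis using assms by (auto simp: A_def)
    next
      case False
      define u where "u x = (INF p\<in>C. p x)" for x
      have bdd: "bdd_below ((\<lambda>p. p x) ` C)" for x
      proof (rule bdd_belowI2)
        fix p assume "p \<in> C"
        then have "sublinear p" "p (- x) \<le> q (- x)" using C by (auto simp: A_def le_fun_def)
        then show "- q (- x) \<le> p x" using sublinearD(4)[of p x] by linarith
      qed
      have le: "u x \<le> p x" if "p \<in> C" for p x unfolding u_def using that by (intro cINF_lower bdd)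
      have ge: "a \<le> u x" if "\<And>p. p \<in> C \<Longrightarrow> a \<le> p x" for a x
        unfolding u_def using that False by (intro cINF_greatest) auto
      have "u (x + y) \<le> u x + u y" for x y
      proof -
        have "u (x + y) - p2 y \<le> p1 x" if "p1 \<in> C" "p2 \<in> C" for p1 p2
        proof -
          obtain p where p: "p \<in> C" "p \<le> p1" "p \<le> p2" using chain[OF \<open>p1 \<in> C\<close> \<open>p2 \<in> C\<close>] \<open>p1 \<in> C\<close> \<open>p2 \<in> C\<close>
            by (metis order_refl)
          have "u (x + y) \<le> p (x + y)" using p(1) by (rule le)
          also have "\<dots> \<le> p x + p y" using p C by (intro sublinearD) (auto simp: A_def)
          also have "\<dots> \<le> p1 x + p2 y" using p by (intro add_mono) (auto simp: le_fun_def)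
          finally show ?thesis by simp
        qed
        then have "u (x + y) - p2 y \<le> u x" if "p2 \<in> C" for p2 using that by (intro ge) auto
        then have "u (x + y) - u x \<le> p2 y" if "p2 \<in> C" for p2
          using that by (force simp: algebra_simps)
        then have "u (x + y) - u x \<le> u y" by (intro ge) auto
        then show ?thesis by simp
      qed
      moreover have "u (t *\<^sub>R x) = t * u x" if "0 \<le> t" for t x
      proof -
        have scale: "p (t *\<^sub>R x) = t * p x" if "p \<in> C" for p
          using that C \<open>0 \<le> t\<close> by (intro sublinearD) (auto simp: A_def)
        show ?thesis
        proof (cases "t = 0")
          case True
          have "u 0 = 0"
            unfolding u_def using False C sublinearD(3) by (subst INF_cong[OF refl, of C _ "\<lambda>_. 0"]) (auto simp: A_def)
          then show ?thesis using True by simp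
        next
          case False
          then have t: "0 < t" using that by simp
          have "u (t *\<^sub>R x) / t \<le> p x" if "p \<in> C" for p
            using le[OF that, of "t *\<^sub>R x"] scale[OF that] t by (simp add: field_simps)
          then have "u (t *\<^sub>R x) / t \<le> u x" by (rule ge)
          moreover have "t * u x \<le> u (t *\<^sub>R x)"
          proof (rule ge)
            fix p assume "p \<in> C"
            then show "t * u x \<le> p (t *\<^sub>R x)" using le[of p x] t by (simp add: scale[OF \<open>p \<in> C\<close>])
          qed
          ultimately show ?thesis using t by (simp add: field_simps)
        qed
      qed
      ultimately have "sublinear u" by (simp add: sublinear_def)
      moreover have "u \<le> q"
      proof (rule le_funI)
        fix x
        obtain p where "p \<in> C" using False by blast
        with C have "p x \<le> q x" by (auto simp: A_def le_fun_def)
        then show "u x \<le> q x" using le[OF \<open>p \<in> C\<close>, of x] by simp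
      qed
      ultimately show ?thesis using le by (auto simp: A_def le_fun_def)
    qed
  qed
  then obtain p where "p \<in> A" "\<And>a. a \<in> A \<Longrightarrow> a \<le> p \<Longrightarrow> a = p" by blast
  then show thesis by (intro that[of p]) (auto simp: A_def intro: order_trans)
qed

definition norming ::
    "('k::real_normed_field \<Rightarrow> 'a::real_normed_vector \<Rightarrow> 'a) \<Rightarrow> ('a \<Rightarrow> 'k) \<Rightarrow> 'a \<Rightarrow> bool" where
  "norming sc f z \<longleftrightarrow> (\<forall>x y. f (x + y) = f x + f y) \<and> (\<forall>c x. f (sc c x) = c * f x) \<and>
     (\<forall>x. norm (f x) \<le> norm x) \<and> f z = of_real (norm z)"

lemma exists_norming_real:
  fixes z :: "'a::real_normed_vector"
  shows "\<exists>f. norming scaleR f z"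
proof -
  have "sublinear (norm :: 'a \<Rightarrow> real)" by (simp add: sublinear_def norm_triangle_ineq)
  note q = tilt[OF this, of z]
  obtain p where p: "sublinear p" "p \<le> tilt norm z"
      and min: "\<And>p'. sublinear p' \<Longrightarrow> p' \<le> p \<Longrightarrow> p' = p"
    using minimal_sublinear_below[OF q(1)] by blast
  have odd: "p (- y) = - p y" for y
  proof (rule antisym)
    have "tilt p y = p" using tilt[OF p(1)] by (intro min) (auto simp: le_fun_def)
    then show "p (- y) \<le> - p y" using tilt(3)[OF p(1), of y] by simp
    show "- p y \<le> p (- y)" using sublinearD(4)[OF p(1), of "- y"] by simp
  qed
  have add: "p (x + y) = p x + p y" for x y
    using sublinearD(1)[OF p(1), of x y] sublinearD(1)[OF p(1), of "- x" "- y"] odd[of "x + y"] odd[of x] odd[of y]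
    by simp
  have scale: "p (c *\<^sub>R x) = c * p x" for c x
  proof (cases "0 \<le> c")
    case False
    then show ?thesis using sublinearD(2)[OF p(1), of "- c" x] odd[of "c *\<^sub>R x"] by simp
  qed (use sublinearD(2)[OF p(1)] in auto)
  have le: "p x \<le> norm x" for x using p(2) q(2)[of x] by (meson le_funD order_trans)
  have bound: "\<bar>p x\<bar> \<le> norm x" for x using le[of x] le[of "- x"] odd[of x] by simp
  have "p (- z) \<le> - norm z" using p(2) q(3) by (meson le_funD order_trans)
  then have "p z = norm z" using odd[of z] le[of z] by simp
  with add scale bound show ?thesis by (auto simp: norming_def)
qed

text \<open>
  The usual complexification: a real norming functional \<open>f\<close> is the real part of the complex linear
  functional \<open>x \<mapsto> f x - \<i> f (\<i> x)\<close>, and rotating \<open>x\<close> until the value is real transfers the bound.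
\<close>

lemma exists_norming_complex:
  fixes sc :: "complex \<Rightarrow> 'a::real_normed_vector \<Rightarrow> 'a"
  assumes sc: "normed_space_over sc"
  shows "\<exists>f. norming sc f z"
proof -
  interpret vector_space sc using sc by (simp add: normed_space_over_def)
  have re: "sc (of_real r) x = r *\<^sub>R x" and norm_sc: "norm (sc c x) = norm c * norm x" for r c x
    using sc by (auto simp: normed_space_over_def)
  obtain f where f: "norming scaleR f z" using exists_norming_real by blast
  then have add: "f (x + y) = f x + f y" and real: "f (r *\<^sub>R x) = r * f x"
    and bound: "\<bar>f x\<bar> \<le> norm x" and z: "f z = norm z" for x y r
    by (auto simp: norming_def)
  define g where "g x = Complex (f x) (- f (sc \<i> x))" for x
  have g_add: "g (x + y) = g x + g y" for x y
    by (simp add: g_def add scale_right_distrib complex_eq_iff)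
  have "sc c x = Re c *\<^sub>R x + Im c *\<^sub>R sc \<i> x" for c x
  proof -
    have "sc c x = sc (of_real (Re c) + of_real (Im c) * \<i>) x" by (simp add: complex_eq mult.commute)
    also have "\<dots> = Re c *\<^sub>R x + Im c *\<^sub>R sc \<i> x"
      by (simp only: scale_left_distrib re flip: scale_scale)
    finally show ?thesis .
  qed
  note sc_eq = this
  have sc_ii: "sc \<i> (sc \<i> x) = - x" for x
    by simp
  have g_sc: "g (sc c x) = c * g x" for c x
  proof -
    have "sc \<i> (sc c x) = Re c *\<^sub>R sc \<i> x + Im c *\<^sub>R (- x)"
      using sc_eq[of c "sc \<i> x"] sc_ii[of x] by (simp add: mult.commute)
    then have "f (sc \<i> (sc c x)) = Re c * f (sc \<i> x) + Im c * f (- x)"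
      by (simp only: add real)
    then have "f (sc \<i> (sc c x)) = Re c * f (sc \<i> x) - Im c * f x"
      using real[of "- 1" x] by simp
    moreover have "f (sc c x) = Re c * f x + Im c * f (sc \<i> x)"
      by (simp only: sc_eq[of c x] add real)
    ultimately show ?thesis by (simp add: g_def complex_eq_iff)
  qed
  have g_bound: "norm (g x) \<le> norm x" for x
  proof (cases "g x = 0")
    case False
    define c where "c = cnj (g x) / of_real (norm (g x))"
    have c: "norm c = 1" using False by (simp add: c_def norm_divide)
    have "g (sc c x) = of_real (norm (g x))"
      using False complex_norm_square[of "g x", symmetric]
      by (simp add: g_sc c_def mult.commute[of "cnj (g x)"] power2_eq_square)
    then have "f (sc c x) = norm (g x)" by (simp add: g_def complex_eq_iff)
    then show ?thesis using bound[of "sc c x"] norm_sc[of c x] c by simp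
  qed simp
  have "g z = of_real (norm z)"
  proof -
    have "(norm (g z))\<^sup>2 = (norm z)\<^sup>2 + (f (sc \<i> z))\<^sup>2"
      by (simp add: g_def z cmod_power2)
    moreover have "(norm (g z))\<^sup>2 \<le> (norm z)\<^sup>2"
      using g_bound[of z] by (intro power_mono) auto
    ultimately have "f (sc \<i> z) = 0" by (simp add: sum_power2_le_zero_iff)
    then show ?thesis by (simp add: g_def z complex_eq_iff)
  qed
  with g_add g_sc g_bound show ?thesis by (auto simp: norming_def)
qed

section \<open>Cardinality of spans and weak-star density\<close>

text \<open>
  Linear combinations over \<open>A\<close> are parametrised by finite subsets of \<open>A\<close> carrying coefficients. The
  bound on the number of parameters is used both for spans of vectors and for spans of functionals.
\<close>

lemma card_of_finite_maps:
  assumes "Cinfinite r" "|A| \<le>o r" "|UNIV :: 'k set| \<le>o r"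
  shows "|SIGMA t:{t. finite t \<and> t \<subseteq> A}. t \<rightarrow>\<^sub>E (UNIV :: 'k set)| \<le>o r"
proof -
  let ?D = "SIGMA t:{t. finite t \<and> t \<subseteq> A}. t \<rightarrow>\<^sub>E (UNIV :: 'k set)"
  let ?\<phi> = "\<lambda>xs. (fst ` set xs, \<lambda>i\<in>fst ` set xs. the (map_of xs i))"
  have "?D \<subseteq> ?\<phi> ` lists (A \<times> UNIV)"
  proof safe
    fix t f assume tf: "finite t" "t \<subseteq> A" "f \<in> t \<rightarrow>\<^sub>E (UNIV :: 'k set)"
    obtain ys where ys: "set ys = t" using finite_list[OF tf(1)] by blast
    let ?xs = "map (\<lambda>i. (i, f i)) ys"
    have "fst ` set ?xs = t" using ys by force
    moreover have "(\<lambda>i\<in>t. the (map_of ?xs i)) = f"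
      using tf(3) ys by (auto simp: fun_eq_iff map_of_map_restrict PiE_def extensional_def)
    moreover have "?xs \<in> lists (A \<times> UNIV)" using ys tf(2) by auto
    ultimately show "(t, f) \<in> ?\<phi> ` lists (A \<times> UNIV)" by (intro image_eqI[of _ _ ?xs]) simp_all
  qed
  then have "|?D| \<le>o |lists (A \<times> (UNIV :: 'k set))|" by (rule surj_imp_ordLeq)
  also have "|lists (A \<times> (UNIV :: 'k set))| \<le>o r"
    using assms by (intro card_of_lists_ordLeq card_of_Times_ordLeq_infinite_Field) (auto simp: cinfinite_def)
  finally show ?thesis .
qed

lemma (in vector_space) card_of_span_ordLeq:
  assumes "Cinfinite r" "|A| \<le>o r" "|UNIV :: 'a set| \<le>o r"
  shows "|span A| \<le>o r"
proof -
  have "span A \<subseteq> (\<lambda>(t, f). \<Sum>a\<in>t. scale (f a) a) `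
      (SIGMA t:{t. finite t \<and> t \<subseteq> A}. t \<rightarrow>\<^sub>E (UNIV :: 'a set))"
  proof
    fix x assume "x \<in> span A"
    then obtain t f where "finite t" "t \<subseteq> A" "x = (\<Sum>a\<in>t. scale (f a) a)"
      by (auto simp: span_explicit)
    then show "x \<in> (\<lambda>(t, f). \<Sum>a\<in>t. scale (f a) a) `
        (SIGMA t:{t. finite t \<and> t \<subseteq> A}. t \<rightarrow>\<^sub>E (UNIV :: 'a set))"
      by (intro image_eqI[of _ _ "(t, restrict f t)"]) (auto intro!: sum.cong)
  qed
  then show ?thesis using card_of_finite_maps[OF assms] surj_imp_ordLeq ordLeq_transitive by blast
qed

lemma card_of_dual_span_ordLeq:
  fixes F :: "('a \<Rightarrow> 'k::field) set"
  assumes "Cinfinite r" "|F| \<le>o r" "|UNIV :: 'k set| \<le>o r"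
  shows "|dual_span Y F| \<le>o r"
proof -
  have "dual_span Y F \<subseteq> (\<lambda>(t, c). \<lambda>y\<in>Y. \<Sum>f\<in>t. c f * f y) `
      (SIGMA t:{t. finite t \<and> t \<subseteq> F}. t \<rightarrow>\<^sub>E (UNIV :: 'k set))"
  proof
    fix g assume "g \<in> dual_span Y F"
    then obtain t c where "finite t" "t \<subseteq> F" "g = (\<lambda>y\<in>Y. \<Sum>f\<in>t. c f * f y)"
      by (auto simp: dual_span_def)
    then show "g \<in> (\<lambda>(t, c). \<lambda>y\<in>Y. \<Sum>f\<in>t. c f * f y) `
        (SIGMA t:{t. finite t \<and> t \<subseteq> F}. t \<rightarrow>\<^sub>E (UNIV :: 'k set))"
      by (intro image_eqI[of _ _ "(t, restrict c t)"]) (auto intro!: sum.cong restrict_ext)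
  qed
  then show ?thesis using card_of_finite_maps[OF assms] surj_imp_ordLeq ordLeq_transitive by blast
qed

lemma dual_span_lincomb:
  assumes "finite K" "\<And>k. k \<in> K \<Longrightarrow> g k \<in> dual_span Y F"
  shows "(\<lambda>y\<in>Y. \<Sum>k\<in>K. d k * g k y) \<in> dual_span Y F"
proof -
  have "\<forall>k\<in>K. \<exists>A c. g k = (\<lambda>y\<in>Y. \<Sum>f\<in>A. c f * f y) \<and> finite A \<and> A \<subseteq> F"
    using assms(2) by (simp only: dual_span_def mem_Collect_eq) simp
  from bchoice[OF this] obtain A
    where "\<forall>k\<in>K. \<exists>c. g k = (\<lambda>y\<in>Y. \<Sum>f\<in>A k. c f * f y) \<and> finite (A k) \<and> A k \<subseteq> F" ..
  from bchoice[OF this] obtain c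
    where A: "\<forall>k\<in>K. g k = (\<lambda>y\<in>Y. \<Sum>f\<in>A k. c k f * f y) \<and> finite (A k) \<and> A k \<subseteq> F" ..
  let ?U = "\<Union>k\<in>K. A k"
  let ?C = "\<lambda>f. \<Sum>k\<in>K. d k * (if f \<in> A k then c k f else 0)"
  have fin: "finite ?U" "?U \<subseteq> F" using A assms(1) by auto
  have "(\<Sum>k\<in>K. d k * g k y) = (\<Sum>f\<in>?U. ?C f * f y)" if "y \<in> Y" for y
  proof -
    have "d k * g k y = (\<Sum>f\<in>?U. d k * (if f \<in> A k then c k f else 0) * f y)" if k: "k \<in> K" for k
    proof -
      have "g k y = (\<Sum>f\<in>A k. c k f * f y)" using A k \<open>y \<in> Y\<close> by simp
      also have "\<dots> = (\<Sum>f\<in>?U. (if f \<in> A k then c k f else 0) * f y)"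
        using fin k by (intro sum.mono_neutral_cong_left) auto
      finally show ?thesis by (simp add: sum_distrib_left mult.assoc)
    qed
    then have "(\<Sum>k\<in>K. d k * g k y) =
        (\<Sum>k\<in>K. \<Sum>f\<in>?U. d k * (if f \<in> A k then c k f else 0) * f y)"
      by (intro sum.cong) auto
    also have "\<dots> = (\<Sum>f\<in>?U. ?C f * f y)"
      by (subst sum.swap) (simp add: sum_distrib_right)
    finally show ?thesis .
  qed
  then have "(\<lambda>y\<in>Y. \<Sum>k\<in>K. d k * g k y) = (\<lambda>y\<in>Y. \<Sum>f\<in>?U. ?C f * f y)"
    by (intro restrict_ext)
  then show ?thesis
    unfolding dual_span_def using fin by (intro CollectI exI[of _ ?U] exI[of _ ?C] conjI)
qed

text \<open>
  The same notion as \<^const>\<open>normed_space_over\<close>, as an extension of the locale of vector spaces, so that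
  span, subspace and independence refer to the scalar field \<open>'k\<close>.
\<close>

locale normed_over = vector_space sc
  for sc :: "'k::real_normed_field \<Rightarrow> 'a::real_normed_vector \<Rightarrow> 'a" +
  assumes sc_of_real: "sc (of_real r) x = r *\<^sub>R x"
    and norm_sc: "norm (sc c x) = norm c * norm x"
begin

lemma dual_sum:
  assumes Y: "subspace Y" and f: "f \<in> dual sc Y" and K: "finite K" "\<And>k. k \<in> K \<Longrightarrow> g k \<in> Y"
  shows "f (\<Sum>k\<in>K. sc (c k) (g k)) = (\<Sum>k\<in>K. c k * f (g k))"
  using K
proof (induction K rule: finite_induct)
  case empty
  have "f (sc 0 0) = 0 * f 0" using f subspace_0[OF Y] unfolding dual_def by blast
  then show ?case by simp
next
  case (insert k K)
  have "(\<Sum>k\<in>K. sc (c k) (g k)) \<in> Y" "sc (c k) (g k) \<in> Y"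
    using insert by (auto intro!: subspace_sum[OF Y] subspace_scale[OF Y])
  then have "f (sc (c k) (g k) + (\<Sum>k\<in>K. sc (c k) (g k))) = c k * f (g k) + f (\<Sum>k\<in>K. sc (c k) (g k))"
    using f insert by (simp add: dual_def)
  then show ?case using insert by simp
qed

lemma dual_span_subset_dual:
  assumes "subspace Y" "F \<subseteq> dual sc Y"
  shows "dual_span Y F \<subseteq> dual sc Y"
proof
  fix g assume "g \<in> dual_span Y F"
  then obtain A c where A: "finite A" "A \<subseteq> F" and g: "g = (\<lambda>y\<in>Y. \<Sum>f\<in>A. c f * f y)"
    by (auto simp: dual_span_def)
  have lin: "f (x + y) = f x + f y" "f (sc d x) = d * f x" if "f \<in> A" "x \<in> Y" "y \<in> Y" for f x y d
    using that A assms(2) unfolding dual_def by blast+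
  have "\<exists>B. \<forall>x\<in>Y. norm (f x) \<le> B * norm x" if "f \<in> A" for f
    using that A assms(2) unfolding dual_def by blast
  then obtain B where B: "\<And>f x. f \<in> A \<Longrightarrow> x \<in> Y \<Longrightarrow> norm (f x) \<le> B f * norm x" by metis
  have "norm (g x) \<le> (\<Sum>f\<in>A. norm (c f) * B f) * norm x" if "x \<in> Y" for x
  proof -
    have "norm (g x) \<le> (\<Sum>f\<in>A. norm (c f) * norm (f x))"
      using that by (simp add: g sum_norm_le norm_mult)
    also have "\<dots> \<le> (\<Sum>f\<in>A. norm (c f) * (B f * norm x))"
      using B that by (intro sum_mono mult_left_mono) auto
    finally show ?thesis by (simp add: sum_distrib_right mult.assoc)
  qed
  moreover have "g (x + y) = g x + g y" if "x \<in> Y" "y \<in> Y" for x y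
  proof -
    have "(\<Sum>f\<in>A. c f * f (x + y)) = (\<Sum>f\<in>A. c f * f x + c f * f y)"
      using lin(1)[OF _ that] by (intro sum.cong refl) (metis distrib_left)
    then show ?thesis using that subspace_add[OF assms(1)] by (simp add: g sum.distrib)
  qed
  moreover have "g (sc d x) = d * g x" if "x \<in> Y" for x d
  proof -
    have "(\<Sum>f\<in>A. c f * f (sc d x)) = (\<Sum>f\<in>A. d * (c f * f x))"
      using lin(2)[OF _ that that] by (intro sum.cong refl) (metis mult.left_commute)
    then show ?thesis using that subspace_scale[OF assms(1)] by (simp add: g sum_distrib_left)
  qed
  ultimately show "g \<in> dual sc Y" unfolding dual_def g by blast
qed

text \<open>
  On a finite dimensional space a separating space of functionals is the whole dual. By induction
  there are functionals \<open>h q\<close> dual to the points \<open>q \<in> P\<close>. Subtracting from a new point \<open>p\<close> its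
  projection along them leaves some \<open>x \<noteq> 0\<close>; any \<open>f \<in> F\<close> with \<open>f x \<noteq> 0\<close>, corrected in the same way,
  vanishes on \<open>P\<close> but not at \<open>p\<close>.
\<close>

lemma total_imp_interpolation:
  assumes Y: "subspace Y" and F: "F \<subseteq> dual sc Y"
    and total: "\<And>x. x \<in> Y \<Longrightarrow> (\<forall>f\<in>F. f x = 0) \<Longrightarrow> x = 0"
    and P: "finite P" "P \<subseteq> Y" "independent P"
  shows "\<exists>g\<in>dual_span Y F. \<forall>p\<in>P. g p = v p"
  using P
proof (induction P arbitrary: v rule: finite_induct)
  case empty
  have "(\<lambda>y\<in>Y. \<Sum>f\<in>{}. (\<lambda>_. 0) f * f y) \<in> dual_span Y F" unfolding dual_span_def
    by (intro CollectI exI[of _ "{}"] exI[of _ "\<lambda>_. 0"]) auto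
  then show ?case by blast
next
  case (insert p P)
  have p: "p \<notin> span P" "p \<in> Y" and P: "P \<subseteq> Y" "independent P"
    using insert by (auto simp: independent_insert)
  have "\<exists>g\<in>dual_span Y F. \<forall>r\<in>P. g r = (if r = q then 1 else 0)" for q
    using insert.IH[OF P, of "\<lambda>r. if r = q then 1 else 0"] .
  then obtain h where h: "\<And>q. h q \<in> dual_span Y F"
      and h_eq: "\<And>q r. r \<in> P \<Longrightarrow> h q r = (if r = q then 1 else 0)" by metis
  define x where "x = p - (\<Sum>q\<in>P. sc (h q p) q)"
  have sumY: "(\<Sum>q\<in>P. sc (h q p) q) \<in> Y"
    using P by (auto intro!: subspace_sum[OF Y] subspace_scale[OF Y])
  have "x \<noteq> 0"
    using p(1) span_sum[of P "\<lambda>q. sc (h q p) q" P] span_scale span_base by (force simp: x_def)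
  moreover have "x \<in> Y" unfolding x_def using sumY p by (intro subspace_diff[OF Y])
  ultimately obtain f where f: "f \<in> F" "f x \<noteq> 0" using total by blast
  then have fd: "f \<in> dual sc Y" using F by blast
  have fx: "f x = f p - (\<Sum>q\<in>P. h q p * f q)"
  proof -
    have "f p = f (x + (\<Sum>q\<in>P. sc (h q p) q))" by (simp add: x_def)
    also have "\<dots> = f x + f (\<Sum>q\<in>P. sc (h q p) q)"
      using fd \<open>x \<in> Y\<close> sumY unfolding dual_def by blast
    also have "f (\<Sum>q\<in>P. sc (h q p) q) = (\<Sum>q\<in>P. h q p * f q)"
      using insert.hyps P by (intro dual_sum[OF Y fd]) auto
    finally show ?thesis by simp
  qed
  have fr: "(\<lambda>y\<in>Y. f y) \<in> dual_span Y F"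
    unfolding dual_span_def using f(1)
    by (intro CollectI exI[of _ "{f}"] exI[of _ "\<lambda>_. 1"]) auto
  \<comment> \<open>The correction of \<open>f\<close> as one linear combination; \<open>None\<close> marks the summand \<open>f\<close> itself.\<close>
  define g where "g = (\<lambda>y\<in>Y. \<Sum>k\<in>insert None (Some ` P).
     (case k of None \<Rightarrow> 1 | Some q \<Rightarrow> - f q) * (case k of None \<Rightarrow> (\<lambda>y\<in>Y. f y) | Some q \<Rightarrow> h q) y)"
  have "g \<in> dual_span Y F"
    unfolding g_def using insert.hyps h fr by (intro dual_span_lincomb) (auto simp del: restrict_apply)
  have g: "g y = f y - (\<Sum>q\<in>P. f q * h q y)" if "y \<in> Y" for y
    using that insert.hyps by (simp add: g_def sum.reindex sum_negf)
  have gP: "g r = 0" if "r \<in> P" for r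
    using that P insert.hyps by (subst g) (auto simp: h_eq if_distrib cong: if_cong)
  have gp: "g p = f x" using p by (simp add: g fx mult.commute)
  obtain h' where h': "h' \<in> dual_span Y F" "\<And>r. r \<in> P \<Longrightarrow> h' r = v r"
    using insert.IH[OF P, of v] by blast
  define G where "G = (\<lambda>y\<in>Y. \<Sum>b\<in>UNIV. (if b then 1 else (v p - h' p) / f x) * (if b then h' else g) y)"
  have "G \<in> dual_span Y F"
    unfolding G_def using h' \<open>g \<in> dual_span Y F\<close> by (intro dual_span_lincomb) auto
  moreover have "G y = h' y + (v p - h' p) / f x * g y" if "y \<in> Y" for y
    using that by (simp add: G_def UNIV_bool)
  then have "\<forall>r\<in>insert p P. G r = v r"
    using p P gP gp h' f(2) by auto
  ultimately show ?case by blast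
qed

text \<open>
  A basic weak-star neighbourhood of \<open>f\<close> restricts the values at finitely many points only, and there
  \<open>f\<close> is even interpolated exactly.
\<close>

lemma total_imp_weak_star_dense:
  assumes Y: "subspace Y" and F: "F \<subseteq> dual sc Y"
    and total: "\<And>x. x \<in> Y \<Longrightarrow> (\<forall>f\<in>F. f x = 0) \<Longrightarrow> x = 0"
  shows "dense_subset (weak_star sc Y) (dual_span Y F)"
proof -
  note sub = dual_span_subset_dual[OF Y F]
  have "f \<in> weak_star sc Y closure_of dual_span Y F" if f: "f \<in> dual sc Y" for f
    unfolding in_closure_of
  proof (intro conjI allI impI)
    show "f \<in> topspace (weak_star sc Y)" using f by simp
    fix T assume "f \<in> T \<and> openin (weak_star sc Y) T"
    then obtain S where S: "openin (product_topology (\<lambda>_. euclidean) Y) S" "T = S \<inter> dual sc Y" "f \<in> S"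
      unfolding weak_star_def openin_subtopology by blast
    from S obtain U where U: "finite {i \<in> Y. U i \<noteq> UNIV}" "f \<in> Pi\<^sub>E Y U" "Pi\<^sub>E Y U \<subseteq> S"
      unfolding openin_product_topology_alt by force
    let ?P = "{i \<in> Y. U i \<noteq> UNIV}"
    obtain B where B: "B \<subseteq> ?P" "independent B" "?P \<subseteq> span B"
      using maximal_independent_subset by blast
    have "finite B" using B(1) U(1) finite_subset by blast
    moreover have BY: "B \<subseteq> Y" using B by auto
    ultimately obtain g where g: "g \<in> dual_span Y F" "\<forall>p\<in>B. g p = f p"
      using total_imp_interpolation[OF Y F total _ _ B(2)] by blast
    have gd: "g \<in> dual sc Y" using g sub by blast
    have "span B \<subseteq> {x \<in> Y. g x = f x}"
    proof (rule span_minimal)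
      show "B \<subseteq> {x \<in> Y. g x = f x}" using g BY by auto
      have "g (sc 0 0) = 0 * g 0" "f (sc 0 0) = 0 * f 0"
        using gd f subspace_0[OF Y] unfolding dual_def by blast+
      then show "subspace {x \<in> Y. g x = f x}"
        using gd f subspace_0[OF Y] subspace_add[OF Y] subspace_scale[OF Y]
        unfolding dual_def by (intro subspaceI) auto
    qed
    then have "g x = f x" if "x \<in> ?P" for x using that B by blast
    then have "g \<in> Pi\<^sub>E Y U"
      using U(2) gd by (auto simp: PiE_iff dual_def) (metis UNIV_I)
    then show "\<exists>y. y \<in> dual_span Y F \<and> y \<in> T" using g gd U(3) S by blast
  qed
  then show ?thesis
    using sub closure_of_subset_topspace[of "weak_star sc Y" "dual_span Y F"]
    by (auto simp: dense_subset_def)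
qed

text \<open>
  How the density hypothesis is used: a family of at most \<open>r\<close> functionals spans only \<open>r\<close> functionals,
  too few to be weak-star dense, so it cannot separate points.
\<close>

lemma exists_common_kernel_vector:
  assumes "Cinfinite r" "|UNIV :: 'k set| \<le>o r" "r <o dens (weak_star sc UNIV)"
    and F: "F \<subseteq> dual sc UNIV" "|F| \<le>o r"
  shows "\<exists>x. x \<noteq> 0 \<and> (\<forall>f\<in>F. f x = 0)"
proof (rule ccontr)
  assume "\<not> ?thesis"
  then have "dense_subset (weak_star sc UNIV) (dual_span UNIV F)"
    using F(1) by (intro total_imp_weak_star_dense) auto
  then have "dens (weak_star sc UNIV) \<le>o |dual_span UNIV F|"
    using dens_attained[of "weak_star sc UNIV"] by metis
  also have "|dual_span UNIV F| \<le>o r" using assms F by (intro card_of_dual_span_ordLeq)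
  finally show False using assms(3) not_ordLess_ordLeq by blast
qed

end

section \<open>Construction of a monotone Auerbach system\<close>

context normed_over
begin

lemma norming_linear:
  assumes "norming sc f z"
  shows "f (x + y) = f x + f y" "f (sc c x) = c * f x" "f 0 = 0" "f (x - y) = f x - f y"
    "f (r *\<^sub>R x) = of_real r * f x"
proof -
  show add: "f (x + y) = f x + f y" for x y using assms by (simp add: norming_def)
  show scale: "f (sc c x) = c * f x" for c x using assms by (simp add: norming_def)
  show "f 0 = 0" using add[of 0 0] by simp
  show "f (x - y) = f x - f y" using add[of "x - y" y] by simp
  show "f (r *\<^sub>R x) = of_real r * f x" using scale[of "of_real r" x] by (simp add: sc_of_real)
qed

lemma norming_bound: "norming sc f z \<Longrightarrow> norm (f x) \<le> norm x"
  by (simp add: norming_def)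

lemma norming_self: "norming sc f z \<Longrightarrow> f z = of_real (norm z)"
  by (simp add: norming_def)

lemma norming_in_dual:
  assumes "norming sc f z" "subspace Y"
  shows "restrict f Y \<in> dual sc Y"
proof -
  have "\<exists>B. \<forall>x\<in>Y. norm (f x) \<le> B * norm x"
    using norming_bound[OF assms(1)] by (intro exI[of _ 1]) simp
  then show ?thesis
    using norming_linear[OF assms(1)] subspace_add[OF assms(2)] subspace_scale[OF assms(2)]
    by (auto simp: dual_def)
qed

lemma norming_zero_on_span:
  assumes "norming sc f z" "\<And>a. a \<in> A \<Longrightarrow> f a = 0" "w \<in> span A"
  shows "f w = 0"
proof -
  have "span A \<subseteq> {x. f x = 0}"
    using assms(2) norming_linear[OF assms(1)] by (intro span_minimal subspaceI) auto
  then show ?thesis using assms(3) by blast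
qed

end

text \<open>
  One norming functional is fixed for every vector, so that statements about functionals become
  statements about the colours \<open>N (b - x) a\<close> of triples of vectors.
\<close>

locale norming_selection = normed_over sc
  for sc :: "'k::real_normed_field \<Rightarrow> 'a::real_normed_vector \<Rightarrow> 'a" +
  fixes N :: "'a \<Rightarrow> 'a \<Rightarrow> 'k"
  assumes norming_N: "norming sc (N z) z"
begin

lemma exists_kernel_of_norming_span:
  assumes r: "Cinfinite r" "|UNIV :: 'k set| \<le>o r" "r <o dens (weak_star sc UNIV)" and A: "|A| \<le>o r"
  shows "\<exists>x. x \<noteq> 0 \<and> (\<forall>z\<in>span A. N z x = 0)"
proof -
  have "|N ` span A| \<le>o r"
    using card_of_image card_of_span_ordLeq[OF r(1) A r(2)] ordLeq_transitive by blast
  moreover have "N ` span A \<subseteq> dual sc UNIV"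
    using norming_in_dual[OF norming_N subspace_UNIV] by (auto simp: restrict_def)
  ultimately show ?thesis using exists_common_kernel_vector[OF r, of "N ` span A"] by blast
qed

text \<open>
  The stepping-up lemma is applied twice. Over \<open>\<mu> = 2\<^sup>\<kappa>\<close>, to the vectors of the space, it makes
  \<open>N (e j - e k) (e i)\<close> independent of \<open>k\<close>; here \<open>R\<close> asks for a nonzero vector annihilated by the norming
  functionals of everything spanned by the earlier vectors, which exists by the density hypothesis.
  Over \<open>\<kappa>\<close>, to the indices of the sequence just obtained, it makes the value independent of \<open>j\<close>; here
  \<open>R\<close> asks for an index above the earlier ones, so that the second sequence is a subsequence of the
  first.
\<close>

lemma exists_homogeneous_vectors:
  fixes \<kappa> :: "'m rel"
  assumes \<kappa>: "Cinfinite \<kappa>" and K: "|UNIV :: 'k set| \<le>o \<kappa>"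
    and big: "ctwo ^c (ctwo ^c \<kappa>) <o dens (weak_star sc UNIV)"
  obtains e :: "'m set \<Rightarrow> 'a" and g where
    "\<And>i. i \<in> Field (cardSuc \<kappa>) \<Longrightarrow> e i \<noteq> 0"
    "\<And>i z. i \<in> Field (cardSuc \<kappa>) \<Longrightarrow> z \<in> span (e ` underS (cardSuc \<kappa>) i) \<Longrightarrow> N z (e i) = 0"
    "\<And>i j k. i \<in> underS (cardSuc \<kappa>) j \<Longrightarrow> j \<in> underS (cardSuc \<kappa>) k \<Longrightarrow> N (e j - e k) (e i) = g i"
proof -
  let ?\<mu> = "ctwo ^c \<kappa>"
  have ctwo: "ctwo \<le>o ctwo" by (rule ordLeq_refl[OF Card_order_ctwo])
  have \<mu>: "Cinfinite ?\<mu>" by (rule Cinfinite_cexp[OF ctwo \<kappa>])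
  have \<mu>2: "Cinfinite (ctwo ^c ?\<mu>)" by (rule Cinfinite_cexp[OF ctwo \<mu>])
  have \<kappa>\<mu>: "\<kappa> \<le>o ?\<mu>" using \<kappa> by (intro ordLess_imp_ordLeq ordLess_ctwo_cexp) auto
  have \<mu>\<mu>2: "?\<mu> \<le>o ctwo ^c ?\<mu>" using \<mu> by (intro ordLess_imp_ordLeq ordLess_ctwo_cexp) auto
  have K\<mu>: "|UNIV :: 'k set| \<le>o ?\<mu>" using K \<kappa>\<mu> ordLeq_transitive by blast
  have K\<mu>2: "|UNIV :: 'k set| \<le>o ctwo ^c ?\<mu>" using K\<mu> \<mu>\<mu>2 ordLeq_transitive by blast
  let ?r1 = "cardSuc ?\<mu>" and ?r = "cardSuc \<kappa>"
  obtain e h where e: "\<And>i. i \<in> Field ?r1 \<Longrightarrow> e i \<noteq> 0 \<and> (\<forall>z\<in>span (e ` underS ?r1 i). N z (e i) = 0)"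
    and h: "\<And>i j k. i \<in> underS ?r1 k \<Longrightarrow> j \<in> underS ?r1 k \<Longrightarrow> N (e j - e k) (e i) = h i j"
  proof (rule end_homogeneous_sequence[OF \<mu> K\<mu>2, of
        "\<lambda>A x. x \<noteq> 0 \<and> (\<forall>z\<in>span A. N z x = 0)" UNIV "\<lambda>a b x. N (b - x) a"], goal_cases)
    case (1 A B x)
    then show ?case using span_mono by blast
  next
    case (2 A)
    then show ?case using exists_kernel_of_norming_span[OF \<mu>2 K\<mu>2 big] by blast
  next
    case (3 e h)
    then show ?case using that by blast
  qed
  obtain s g where s: "\<And>i. i \<in> Field ?r \<Longrightarrow> s i \<in> Field ?r1"
      "\<And>i. i \<in> Field ?r \<Longrightarrow> s ` underS ?r i \<subseteq> underS ?r1 (s i)"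
    and g: "\<And>i j k. i \<in> underS ?r k \<Longrightarrow> j \<in> underS ?r k \<Longrightarrow> h (s i) (s k) = g i j"
  proof (rule end_homogeneous_sequence[OF \<kappa> K\<mu>, of
        "\<lambda>A x. A \<subseteq> underS ?r1 x" "Field ?r1" "\<lambda>a b x. h a x"], goal_cases)
    case (1 A B x)
    then show ?case by blast
  next
    case (2 A)
    then show ?case
      using \<mu> by (intro large_subset_cardSuc_unbounded[OF \<mu>] cardSuc_not_ordLeq) auto
  next
    case (3 e h)
    then show ?case using that by blast
  qed
  have F: "j \<in> Field ?r" if "i \<in> underS ?r j" for i j using that by (auto simp: underS_def Field_def)
  show thesis
  proof (rule that[of "e \<circ> s" "\<lambda>i. g i i"])
    fix i assume i: "i \<in> Field ?r"
    show "(e \<circ> s) i \<noteq> 0" using e s i by auto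
    fix z assume "z \<in> span ((e \<circ> s) ` underS ?r i)"
    moreover have "(e \<circ> s) ` underS ?r i \<subseteq> e ` underS ?r1 (s i)" using s(2)[OF i] by auto
    ultimately have "z \<in> span (e ` underS ?r1 (s i))" using span_mono by blast
    then show "N z ((e \<circ> s) i) = 0" using e[OF s(1)[OF i]] by simp
  next
    fix i j k assume ij: "i \<in> underS ?r j" and jk: "j \<in> underS ?r k"
    have "s i \<in> underS ?r1 (s j)" "s j \<in> underS ?r1 (s k)"
      using s(2) ij jk F by blast+
    moreover from this have "s i \<in> underS ?r1 (s k)"
      using cardSuc_Well_order[of ?\<mu>] \<mu> by (meson underS_E order_on_defs subset_iff underS_incr)
    ultimately have "N (e (s j) - e (s k)) (e (s i)) = h (s i) (s j)" by (intro h)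
    also have "\<dots> = g i i" using g[OF ij ij] .
    finally show "N ((e \<circ> s) j - (e \<circ> s) k) ((e \<circ> s) i) = g i i" by simp
  qed
qed

text \<open>
  As there are at most \<open>\<kappa>\<close> scalars, \<open>g\<close> is constant on a set of \<open>\<kappa>\<^sup>+\<close> indices, from which the pairs
  \<open>a i < b i\<close> are chosen by recursion, each above all earlier pairs.
\<close>

lemma exists_paired_indices:
  fixes \<kappa> :: "'m rel" and g :: "'m set \<Rightarrow> 'k"
  assumes \<kappa>: "Cinfinite \<kappa>" and K: "|UNIV :: 'k set| \<le>o \<kappa>"
  obtains a b :: "'m set \<Rightarrow> 'm set" and d where
    "\<And>i. i \<in> Field (cardSuc \<kappa>) \<Longrightarrow> g (a i) = d \<and> g (b i) = d \<and> a i \<in> underS (cardSuc \<kappa>) (b i)"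
    "\<And>i j. j \<in> underS (cardSuc \<kappa>) i \<Longrightarrow> b j \<in> underS (cardSuc \<kappa>) (a i)"
proof -
  let ?r = "cardSuc \<kappa>"
  have wo: "Well_order ?r" using \<kappa> cardSuc_Well_order by blast
  have "\<exists>d. \<not> |{i \<in> Field ?r. g i = d}| \<le>o \<kappa>"
  proof (rule ccontr)
    assume "\<not> ?thesis"
    then have "|\<Union>d\<in>UNIV. {i \<in> Field ?r. g i = d}| \<le>o \<kappa>"
      using \<kappa> K by (intro UNION_Cinfinite_bound) auto
    moreover have "(\<Union>d\<in>UNIV. {i \<in> Field ?r. g i = d}) = Field ?r" by auto
    ultimately show False using cardSuc_not_ordLeq \<kappa> by metis
  qed
  then obtain d where d: "\<not> |{i \<in> Field ?r. g i = d}| \<le>o \<kappa>" ..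
  let ?T = "{i \<in> Field ?r. g i = d}"
  have above: "\<exists>t\<in>?T. A \<subseteq> underS ?r t" if "A \<subseteq> Field ?r" "|A| \<le>o \<kappa>" for A
    using that d by (intro large_subset_cardSuc_unbounded[OF \<kappa>]) auto
  let ?P = "\<lambda>f i p. fst p \<in> ?T \<and> snd p \<in> ?T \<and> fst p \<in> underS ?r (snd p) \<and>
    (\<forall>j\<in>underS ?r i. snd (f j) \<in> underS ?r (fst p))"
  have "\<exists>f. \<forall>i\<in>Field ?r. ?P f i (f i)"
  proof (rule well_order_recursive_choice[OF wo])
    fix i and f :: "'m set \<Rightarrow> 'm set \<times> 'm set"
    assume i: "i \<in> Field ?r" and IH: "\<And>j. j \<in> underS ?r i \<Longrightarrow> ?P f j (f j)"
    have "|(\<lambda>j. snd (f j)) ` underS ?r i| \<le>o \<kappa>"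
      using card_of_image cardSuc_under_ordLeq(1)[OF \<kappa> i] ordLeq_transitive by blast
    moreover have "(\<lambda>j. snd (f j)) ` underS ?r i \<subseteq> Field ?r" using IH by auto
    ultimately obtain a where a: "a \<in> ?T" "(\<lambda>j. snd (f j)) ` underS ?r i \<subseteq> underS ?r a"
      using above by blast
    have "|{a}| \<le>o \<kappa>" using \<kappa> by (intro Card_order_singl_ordLeq) (auto simp: cinfinite_def)
    then obtain b where "b \<in> ?T" "{a} \<subseteq> underS ?r b" using above[of "{a}"] a by blast
    then show "\<exists>p. ?P f i p" using a by (intro exI[of _ "(a, b)"]) auto
  qed auto
  then obtain f where f: "\<And>i. i \<in> Field ?r \<Longrightarrow> ?P f i (f i)" by blast
  have F: "j \<in> Field ?r" if "i \<in> underS ?r j" for i j using that by (auto simp: underS_def Field_def)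
  show thesis
    using f F by (intro that[of "fst \<circ> f" d "snd \<circ> f"]) auto
qed

text \<open>
  The vectors are the normalised differences of \<open>e (a i)\<close> and \<open>e (b i)\<close>, and \<open>\<psi> i\<close> is norming for the \<open>i\<close>-th
  of them. Vectors of later pairs are annihilated by \<open>\<psi> i\<close> by the choice of the sequence \<open>e\<close>. On the
  vectors \<open>e (a j)\<close> and \<open>e (b j)\<close> of an earlier pair \<open>\<psi> i\<close> need not vanish, but by homogeneity it takes the same
  value \<open>d\<close> at both, so it vanishes at their difference.
\<close>

lemma exists_monotone_Auerbach_system:
  fixes \<kappa> :: "'m rel"
  assumes \<kappa>: "Cinfinite \<kappa>" and K: "|UNIV :: 'k set| \<le>o \<kappa>"
    and big: "ctwo ^c (ctwo ^c \<kappa>) <o dens (weak_star sc UNIV)"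
  obtains u :: "'m set \<Rightarrow> 'a" and \<psi> where
    "\<And>i. i \<in> Field (cardSuc \<kappa>) \<Longrightarrow> norm (u i) = 1 \<and> norming sc (\<psi> i) (u i)"
    "\<And>i j. i \<in> Field (cardSuc \<kappa>) \<Longrightarrow> j \<in> Field (cardSuc \<kappa>) \<Longrightarrow> i \<noteq> j \<Longrightarrow> \<psi> i (u j) = 0"
    "\<And>i z. i \<in> Field (cardSuc \<kappa>) \<Longrightarrow> z \<in> span (u ` underS (cardSuc \<kappa>) i) \<Longrightarrow> N z (u i) = 0"
proof -
  let ?r = "cardSuc \<kappa>"
  obtain e :: "'m set \<Rightarrow> 'a" and g where e0: "\<And>i. i \<in> Field ?r \<Longrightarrow> e i \<noteq> 0"
    and e: "\<And>i z. i \<in> Field ?r \<Longrightarrow> z \<in> span (e ` underS ?r i) \<Longrightarrow> N z (e i) = 0"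
    and g: "\<And>i j k. i \<in> underS ?r j \<Longrightarrow> j \<in> underS ?r k \<Longrightarrow> N (e j - e k) (e i) = g i"
    using exists_homogeneous_vectors[OF \<kappa> K big] by blast
  obtain a b d where ab: "\<And>i. i \<in> Field ?r \<Longrightarrow> g (a i) = d \<and> g (b i) = d \<and> a i \<in> underS ?r (b i)"
    and ba: "\<And>i j. j \<in> underS ?r i \<Longrightarrow> b j \<in> underS ?r (a i)"
    by (rule exists_paired_indices[OF \<kappa> K, of g]) (rule that)
  have wo: "Well_order ?r" using \<kappa> cardSuc_Well_order by blast
  have tr: "k \<in> underS ?r m" if "k \<in> underS ?r l" "l \<in> underS ?r m" for k l m
    using that wo underS_incr[of ?r l m] by (auto simp: order_on_defs underS_def)
  have F: "j \<in> Field ?r" "i \<in> Field ?r" if "i \<in> underS ?r j" for i j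
    using that by (auto simp: underS_def Field_def)
  define D where "D i = e (a i) - e (b i)" for i
  define u where "u i = D i /\<^sub>R norm (D i)" for i
  have u_sc: "u i = sc (of_real (inverse (norm (D i)))) (D i)" for i by (simp only: u_def sc_of_real)
  note lin = norming_linear[OF norming_N]
  have D0: "D i \<noteq> 0" if i: "i \<in> Field ?r" for i
  proof
    assume "D i = 0"
    then have "e (a i) = e (b i)" by (simp add: D_def)
    moreover have "N (e (a i)) (e (b i)) = 0"
      using ab[OF i] F by (intro e span_base) auto
    ultimately have "e (a i) = 0" using norming_self[OF norming_N, of "e (a i)"] by simp
    then show False using e0 ab[OF i] F by blast
  qed
  have left: "N (D i) (u j) = 0" if j: "j \<in> underS ?r i" for i j
  proof -
    have "a j \<in> underS ?r (a i)" "b j \<in> underS ?r (a i)"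
      using ba[OF j] ab[OF F(2)[OF j]] tr by blast+
    then have "N (D i) (e (a j)) = d" "N (D i) (e (b j)) = d"
      using g ab F j unfolding D_def by metis+
    then show ?thesis by (simp add: u_def lin D_def[of j])
  qed
  have right: "N z (u i) = 0" if i: "i \<in> Field ?r" and z: "z \<in> span (e ` underS ?r (a i))" for i z
  proof -
    have sub: "underS ?r (a i) \<subseteq> underS ?r (b i)" using ab[OF i] tr by blast
    have "z \<in> span (e ` underS ?r (b i))"
      using z by (rule subsetD[OF span_mono[OF image_mono[OF sub]]])
    then have "N z (e (a i)) = 0" "N z (e (b i)) = 0"
      using z ab[OF i] F by (auto intro: e)
    then show ?thesis by (simp add: u_def lin D_def)
  qed
  have D_span: "D j \<in> span (e ` underS ?r (a i))" if j: "j \<in> underS ?r i" for i j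
    unfolding D_def using ba[OF j] ab[OF F(2)[OF j]] tr by (intro span_diff span_base) auto
  show thesis
  proof (rule that[of u "\<lambda>i. N (D i)"])
    fix i assume i: "i \<in> Field ?r"
    have 1: "norm (u i) = 1" using D0[OF i] by (simp add: u_def)
    have "N (D i) (u i) = 1"
      using D0[OF i] norming_self[OF norming_N, of "D i"] by (simp add: u_def lin flip: of_real_mult)
    with 1 show "norm (u i) = 1 \<and> norming sc (N (D i)) (u i)"
      using norming_N[of "D i"] by (simp add: norming_def)
  next
    fix i j assume ij: "i \<in> Field ?r" "j \<in> Field ?r" "i \<noteq> j"
    then have "j \<in> underS ?r i \<or> i \<in> underS ?r j"
      using wo by (auto simp: order_on_defs total_on_def underS_def)
    then show "N (D i) (u j) = 0" using left right[OF ij(2)] D_span by blast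
  next
    fix i z assume i: "i \<in> Field ?r" and z: "z \<in> span (u ` underS ?r i)"
    have "span (u ` underS ?r i) \<subseteq> span (e ` underS ?r (a i))"
      using D_span by (intro span_minimal subspace_span) (auto simp: u_sc intro!: span_scale)
    then show "N z (u i) = 0" using right[OF i] z by blast
  qed
qed

end

section \<open>The closed span of a monotone Auerbach system\<close>

lemma finite_subset_has_max:
  assumes "Well_order r" "finite t" "t \<noteq> {}" "t \<subseteq> Field r"
  shows "\<exists>m\<in>t. t \<subseteq> under r m"
  using assms(2-)
proof (induction t rule: finite_ne_induct)
  case (singleton x)
  then show ?case using assms(1) by (auto simp: under_def order_on_defs refl_on_def)
next
  case (insert x t)
  then obtain m where m: "m \<in> t" "t \<subseteq> under r m" by auto
  have lin: "refl_on (Field r) r" "trans r" "total_on (Field r) r"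
    using assms(1) by (auto simp: order_on_defs)
  show ?case
  proof (cases "(x, m) \<in> r")
    case True
    then show ?thesis using m by (auto simp: under_def)
  next
    case False
    then have "(m, x) \<in> r" "(x, x) \<in> r" using lin m insert.prems
      by (auto simp: total_on_def refl_on_def) (metis subsetD)
    then show ?thesis using m lin(2) by (auto simp: under_def dest: transD)
  qed
qed

context normed_over
begin

lemma bounded_linear_sc: "bounded_linear (sc c)"
proof (rule bounded_linear_intro)
  show "sc c (x + y) = sc c x + sc c y" for x y by (rule scale_right_distrib)
  show "sc c (r *\<^sub>R x) = r *\<^sub>R sc c x" for r x
    using scale_scale[of c "of_real r" x] scale_scale[of "of_real r" c x] by (simp only: sc_of_real mult.commute)
  show "norm (sc c x) \<le> norm x * norm c" for x by (simp add: norm_sc mult.commute)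
qed

lemma subspace_closure:
  assumes "subspace S"
  shows "subspace (closure S)"
proof (rule subspaceI)
  show "0 \<in> closure S" using subspace_0[OF assms] closure_subset by blast
next
  fix x y assume "x \<in> closure S" "y \<in> closure S"
  then obtain f g where "\<forall>n. f n \<in> S" "f \<longlonglongrightarrow> x" "\<forall>n. g n \<in> S" "g \<longlonglongrightarrow> y"
    by (auto simp: closure_sequential)
  then show "x + y \<in> closure S"
    using subspace_add[OF assms] unfolding closure_sequential
    by (intro exI[of _ "\<lambda>n. f n + g n"]) (auto intro: tendsto_add)
next
  fix c x assume "x \<in> closure S"
  then obtain f where "\<forall>n. f n \<in> S" "f \<longlonglongrightarrow> x" by (auto simp: closure_sequential)
  then show "sc c x \<in> closure S"
    using subspace_scale[OF assms] unfolding closure_sequential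
    by (intro exI[of _ "\<lambda>n. sc c (f n)"]) (auto intro: bounded_linear.tendsto[OF bounded_linear_sc])
qed

end

text \<open>
  Beyond biorthogonality with constants one, the last condition makes the vectors a long monotone basic
  sequence: adding a vector of a tail does not decrease the norm of a vector of the head. Without it the
  coordinate functionals might fail to separate the points of the closed span.
\<close>

locale monotone_Auerbach_system = norming_selection sc N
  for sc :: "'k::real_normed_field \<Rightarrow> 'a::real_normed_vector \<Rightarrow> 'a" and N +
  fixes r :: "'i rel" and u :: "'i \<Rightarrow> 'a" and \<psi> :: "'i \<Rightarrow> 'a \<Rightarrow> 'k"
  assumes wo: "Well_order r"
    and norm_u: "i \<in> Field r \<Longrightarrow> norm (u i) = 1"
    and norming_\<psi>: "i \<in> Field r \<Longrightarrow> norming sc (\<psi> i) (u i)"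
    and orthogonal: "i \<in> Field r \<Longrightarrow> j \<in> Field r \<Longrightarrow> i \<noteq> j \<Longrightarrow> \<psi> i (u j) = 0"
    and monotone: "i \<in> Field r \<Longrightarrow> z \<in> span (u ` underS r i) \<Longrightarrow> N z (u i) = 0"
begin

lemma aboveS_iff: "k \<in> aboveS r i \<longleftrightarrow> k \<in> Field r \<and> i \<in> underS r k"
  by (auto simp: aboveS_def underS_def Field_def)

lemma \<psi>_u: "i \<in> Field r \<Longrightarrow> \<psi> i (u i) = 1"
  using norming_self[OF norming_\<psi>] norm_u by simp

lemma underS_trans: "k \<in> underS r l \<Longrightarrow> l \<in> underS r m \<Longrightarrow> k \<in> underS r m"
  using wo underS_incr[of r l m] by (auto simp: order_on_defs underS_def)

text \<open>
  The functional \<open>N z\<close> is norming for the head \<open>z\<close> and annihilates the tail.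
\<close>

lemma norm_le_norm_add_tail:
  assumes "z \<in> span (u ` under r m)" "w \<in> span (u ` aboveS r m)"
  shows "norm z \<le> norm (z + w)"
proof -
  have "N z (u k) = 0" if "k \<in> aboveS r m" for k
  proof (rule monotone)
    have "under r m \<subseteq> underS r k"
    proof
      fix l assume "l \<in> under r m"
      then have "l = m \<or> l \<in> underS r m" by (auto simp: under_def underS_def)
      then show "l \<in> underS r k" using that underS_trans[of l m k] by (auto simp: aboveS_iff)
    qed
    then show "z \<in> span (u ` underS r k)"
      using assms(1) by (rule subsetD[OF span_mono[OF image_mono]])
  qed (use that in \<open>auto simp: aboveS_iff\<close>)
  then have "N z w = 0" using norming_zero_on_span[OF norming_N _ assms(2)] by blast
  then have "of_real (norm z) = N z (z + w)"
    using norming_linear(1)[OF norming_N] norming_self[OF norming_N] by simp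
  then have "norm z = norm (N z (z + w))" by (metis abs_norm_cancel norm_of_real)
  also have "\<dots> \<le> norm (z + w)" by (rule norming_bound[OF norming_N])
  finally show ?thesis .
qed

text \<open>
  A vector \<open>x\<close> that lies in the closed spans of all tails has no head: the head \<open>z\<close> of any approximation
  \<open>z + v\<close> is at most as large as the error. Only finitely many vectors occur in \<open>z\<close>, so some tail lies
  beyond all of them, and \<open>x\<close> may be replaced by an element of this tail.
\<close>

lemma norm_head_le:
  assumes S: "S \<subseteq> Field r" and x: "\<And>k. k \<in> S \<Longrightarrow> x \<in> closure (span (u ` aboveS r k))"
    and z: "z \<in> span (u ` S)" and v: "\<And>k. k \<in> S \<Longrightarrow> v \<in> span (u ` aboveS r k)"
  shows "norm z \<le> norm (x - (z + v))"
proof -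
  obtain t where t: "finite t" "t \<subseteq> S" "z \<in> span (u ` t)"
  proof -
    obtain T c where T: "finite T" "T \<subseteq> u ` S" "z = (\<Sum>a\<in>T. sc (c a) a)"
      using z by (auto simp: span_explicit)
    obtain t where "t \<subseteq> S" "finite t" "T = u ` t"
      using finite_subset_image[OF T(1,2)] by blast
    moreover have "z \<in> span T" unfolding T(3) by (intro span_sum span_scale span_base)
    ultimately show thesis using that by blast
  qed
  show ?thesis
  proof (cases "t = {}")
    case False
    then obtain m where m: "m \<in> t" "t \<subseteq> under r m" 
      using finite_subset_has_max[OF wo t(1)] t S by blast
    have zm: "z \<in> span (u ` under r m)"
      using t(3) by (rule subsetD[OF span_mono[OF image_mono[OF m(2)]]])
    have mS: "m \<in> S" using m t by blast
    show ?thesis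
    proof (rule field_le_epsilon)
      fix e :: real assume "0 < e"
      then obtain w where w: "w \<in> span (u ` aboveS r m)" "dist w x < e"
        using x[OF mS] unfolding closure_approachable by blast
      have "norm z \<le> norm (z + (v - w))"
        using zm span_diff[OF v[OF mS] w(1)] by (rule norm_le_norm_add_tail)
      also have "z + (v - w) = (x - w) - (x - (z + v))" by simp
      also have "norm \<dots> \<le> norm (x - w) + norm (x - (z + v))" by (rule norm_triangle_ineq4)
      finally show "norm z \<le> norm (x - (z + v)) + e"
        using w(2) by (simp add: dist_norm norm_minus_commute)
    qed
  qed (use t in auto)
qed

text \<open>
  By transfinite induction \<open>x\<close> lies in the closed span of the vectors beyond \<open>i\<close>. Approximate \<open>x\<close> by
  \<open>z + sc c (u i) + w\<close> with \<open>z\<close> before and \<open>w\<close> beyond \<open>i\<close>. The head \<open>z\<close> is small by the induction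
  hypothesis, and then \<open>c\<close> is small because \<open>\<psi> i x = 0\<close>. Once \<open>x\<close> is in the closed span of every
  tail, its approximations in the span of all the vectors are themselves heads, hence small.
\<close>

lemma coordinates_total:
  assumes x: "x \<in> closure (span (u ` Field r))" and zero: "\<And>i. i \<in> Field r \<Longrightarrow> \<psi> i x = 0"
  shows "x = 0"
proof -
  have wf: "wf (r - Id)" using wo by (simp add: well_order_on_def)
  have tail: "x \<in> closure (span (u ` aboveS r i))" if "i \<in> Field r" for i
    using that
  proof (induction i rule: wf_induct_rule[OF wf])
    case (1 i)
    have IH: "x \<in> closure (span (u ` aboveS r k))" if "k \<in> underS r i" for k
      using 1(1)[of k] that by (auto simp: underS_def Field_def)
    have split: "Field r = underS r i \<union> insert i (aboveS r i)"
    proof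
      have "\<forall>k\<in>Field r. k \<noteq> i \<longrightarrow> (k, i) \<in> r \<or> (i, k) \<in> r"
        using 1(2) wo by (auto simp: order_on_defs total_on_def)
      then show "Field r \<subseteq> underS r i \<union> insert i (aboveS r i)"
        by (auto simp: underS_def aboveS_def)
      show "underS r i \<union> insert i (aboveS r i) \<subseteq> Field r"
        using 1(2) by (auto simp: underS_def aboveS_def intro: FieldI1 FieldI2)
    qed
    show ?case
      unfolding closure_approachable
    proof (intro allI impI)
      fix e :: real assume "0 < e"
      then obtain y where y: "y \<in> span (u ` Field r)" "dist y x < e / 4"
        using x unfolding closure_approachable by (meson divide_pos_pos zero_less_numeral)
      have eq: "u ` Field r = u ` underS r i \<union> insert (u i) (u ` aboveS r i)"
        by (subst split) (simp add: image_Un)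
      obtain z y' where z: "z \<in> span (u ` underS r i)" "y' \<in> span (insert (u i) (u ` aboveS r i))" "y = z + y'"
        using y(1) unfolding eq span_Un by blast
      then obtain c where w: "y' - sc c (u i) \<in> span (u ` aboveS r i)"
        by (auto simp: span_insert)
      define w where "w = y' - sc c (u i)"
      have y': "y' = sc c (u i) + w" by (simp add: w_def)
      have "norm z \<le> norm (x - (z + y'))"
      proof (rule norm_head_le[OF _ IH z(1)])
        show "underS r i \<subseteq> Field r" by (auto simp: underS_def Field_def)
        fix k assume k: "k \<in> underS r i"
        have "insert i (aboveS r i) \<subseteq> aboveS r k" using k 1(2) underS_trans[OF k] by (auto simp: aboveS_iff)
        then have "insert (u i) (u ` aboveS r i) \<subseteq> u ` aboveS r k" by blast
        then show "y' \<in> span (u ` aboveS r k)" using z(2) by (rule subsetD[OF span_mono])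
      qed
      also have d: "norm (x - (z + y')) < e / 4" using y(2) z(3) by (simp add: dist_norm norm_minus_commute)
      finally have nz: "norm z < e / 4" .
      have "x - y' = (x - (z + y')) + z" by simp
      then have xy: "norm (x - y') < e / 2"
        using norm_triangle_ineq[of "x - (z + y')" z] d nz by simp
      note lin = norming_linear[OF norming_\<psi>[OF 1(2)]]
      have "\<psi> i (u k) = 0" if "k \<in> aboveS r i" for k
        using that 1(2) by (intro orthogonal) (auto simp: aboveS_iff underS_def)
      then have "\<psi> i w = 0"
        using norming_zero_on_span[OF norming_\<psi>[OF 1(2)] _ w] by (auto simp: w_def)
      then have "\<psi> i (x - y') = - c" using zero[OF 1(2)] \<psi>_u[OF 1(2)] by (simp add: lin y')
      then have c: "norm c < e / 2"
        using norming_bound[OF norming_\<psi>[OF 1(2)], of "x - y'"] xy by simp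
      have "x - w = (x - y') + sc c (u i)" by (simp add: y')
      then have "norm (x - w) \<le> norm (x - y') + norm (sc c (u i))" by (metis norm_triangle_ineq)
      also have "\<dots> < e" using xy c norm_u[OF 1(2)] by (simp add: norm_sc)
      finally show "\<exists>y\<in>span (u ` aboveS r i). dist y x < e"
        using w by (intro bexI[of _ w]) (auto simp: dist_norm norm_minus_commute w_def)
    qed
  qed
  have "norm x \<le> 0"
  proof (rule field_le_epsilon)
    fix e :: real assume "0 < e"
    then obtain z where z: "z \<in> span (u ` Field r)" "dist z x < e / 2"
      using x unfolding closure_approachable by (meson half_gt_zero)
    have "norm z \<le> norm (x - (z + 0))"
      using tail z(1) by (intro norm_head_le[OF subset_refl]) (auto intro: span_zero)
    then show "norm x \<le> 0 + e"
      using z(2) norm_triangle_ineq[of "x - z" z] by (simp add: dist_norm norm_minus_commute)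
  qed
  then show "x = 0" by simp
qed

abbreviation "Y \<equiv> closure (span (u ` Field r))"

lemma subspace_Y: "subspace Y"
  by (intro subspace_closure subspace_span)

lemma u_in_Y: "i \<in> Field r \<Longrightarrow> u i \<in> Y"
  by (intro subsetD[OF closure_subset] span_base imageI)

lemma closed_subspace_Y: "closed_subspace sc Y"
  using subspace_Y by (simp add: closed_subspace_def)

lemma inj_on_u: "inj_on u (Field r)"
proof (rule inj_onI, rule ccontr)
  fix i j assume ij: "i \<in> Field r" "j \<in> Field r" "u i = u j" "i \<noteq> j"
  then show False using \<psi>_u[OF ij(1)] orthogonal[OF ij(1,2,4)] by simp
qed

lemma dense_span: "dense_subset (top_of_set Y) (span (u ` Field r))"
proof -
  have sub: "span (u ` Field r) \<subseteq> Y" by (rule closure_subset)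
  have "top_of_set Y closure_of span (u ` Field r) = Y \<inter> closure (Y \<inter> span (u ` Field r))"
    by (simp only: closure_of_subtopology euclidean_closure_of)
  also have "\<dots> = Y" using sub by (simp add: Int_absorb1)
  finally show ?thesis using sub by (simp add: dense_subset_def)
qed

text \<open>
  The vectors serve as their own indices, so the functionals have to be pulled back along \<open>u\<close>.
\<close>

lemma has_Auerbach_basis_Y: "has_Auerbach_basis sc Y"
proof -
  define xs where "xs v = restrict (\<psi> (inv_into (Field r) u v)) Y" for v
  have xs_u: "xs (u i) = restrict (\<psi> i) Y" if "i \<in> Field r" for i
    using that by (simp add: xs_def inv_into_f_f[OF inj_on_u])
  have dual: "restrict (\<psi> i) Y \<in> dual sc Y" if "i \<in> Field r" for i
    using norming_in_dual[OF norming_\<psi>[OF that] subspace_Y] .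
  have "dense_subset (weak_star sc Y) (dual_span Y (xs ` u ` Field r))"
  proof (rule total_imp_weak_star_dense[OF subspace_Y])
    show "xs ` u ` Field r \<subseteq> dual sc Y" using xs_u dual by auto
    fix x assume x: "x \<in> Y" "\<forall>f\<in>xs ` u ` Field r. f x = 0"
    then have "\<psi> i x = 0" if "i \<in> Field r" for i using xs_u[OF that] that x by force
    then show "x = 0" using coordinates_total x(1) by blast
  qed
  moreover have "dual_norm Y (restrict (\<psi> i) Y) = 1" if i: "i \<in> Field r" for i
    unfolding dual_norm_def
  proof (rule cSup_eq_maximum)
    show "1 \<in> (\<lambda>x. norm (restrict (\<psi> i) Y x)) ` {x \<in> Y. norm x \<le> 1}"
      using u_in_Y[OF i] norm_u[OF i] \<psi>_u[OF i] by (intro image_eqI[of _ _ "u i"]) auto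
    show "y \<le> 1" if "y \<in> (\<lambda>x. norm (restrict (\<psi> i) Y x)) ` {x \<in> Y. norm x \<le> 1}" for y
      using that norming_bound[OF norming_\<psi>[OF i]] order_trans by auto
  qed
  ultimately have "Auerbach_basis sc Y (u ` Field r) (\<lambda>v. v) xs"
    unfolding Auerbach_basis_def M_basis_def
    using dense_span xs_u dual u_in_Y \<psi>_u orthogonal norm_u inj_on_u
    by (auto simp: inj_on_eq_iff)
  then show ?thesis unfolding has_Auerbach_basis_def by blast
qed

text \<open>
  The vectors \<open>u i\<close> are at mutual distance at least one, because \<open>\<psi> i (u i - u j) = 1\<close>; hence points of a
  dense set within \<open>1/2\<close> of them are distinct. Conversely the span is dense and has no more elements
  than \<open>r\<close>.
\<close>

lemma dens_Y:
  assumes "Card_order r" "infinite (Field r)" "|UNIV :: 'k set| \<le>o r"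
  shows "dens (top_of_set Y) =o r"
proof -
  obtain D where D': "dense_subset (top_of_set Y) D \<and> dens (top_of_set Y) = |D| \<and>
      (\<forall>E. dense_subset (top_of_set Y) E \<longrightarrow> |D| \<le>o |E| )"
    using dens_attained[of "top_of_set Y"] ..
  note D = conjunct1[OF D'] conjunct1[OF conjunct2[OF D']] conjunct2[OF conjunct2[OF D'], rule_format]
  have r: "|Field r| =o r" using assms(1) by (rule card_of_Field_ordIso)
  have "|D| \<le>o |span (u ` Field r)|" using D(3) dense_span .
  also have "|span (u ` Field r)| \<le>o r"
    using assms ordLeq_ordIso_trans[OF card_of_image r]
    by (intro card_of_span_ordLeq) (auto simp: cinfinite_def)
  finally have 1: "|D| \<le>o r" .
  have clD: "Y \<subseteq> closure D"
  proof -
    have "Y = top_of_set Y closure_of D" using D(1) by (simp add: dense_subset_def)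
    also have "\<dots> \<subseteq> closure D" by (simp add: closure_of_subtopology closure_mono le_infI2)
    finally show ?thesis .
  qed
  have "\<exists>y\<in>D. dist y (u i) < 1 / 2" if "i \<in> Field r" for i
    using closure_approachable[THEN iffD1, rule_format, OF subsetD[OF clD u_in_Y[OF that]], of "1 / 2"]
    by simp
  then obtain y where y: "\<And>i. i \<in> Field r \<Longrightarrow> y i \<in> D \<and> dist (y i) (u i) < 1 / 2" by metis
  have "inj_on y (Field r)"
  proof (rule inj_onI, rule ccontr)
    fix i j assume ij: "i \<in> Field r" "j \<in> Field r" "y i = y j" "i \<noteq> j"
    have "\<psi> i (u i - u j) = 1"
      using ij \<psi>_u orthogonal by (simp add: norming_linear[OF norming_\<psi>])
    then have "1 \<le> dist (u i) (u j)"
      using norming_bound[OF norming_\<psi>[OF ij(1)], of "u i - u j"] by (simp add: dist_norm)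
    also have "\<dots> \<le> dist (y i) (u i) + dist (y i) (u j)" by (rule dist_triangle3)
    also have "\<dots> < 1" using y[OF ij(1)] y[OF ij(2)] ij(3) by simp
    finally show False by simp
  qed
  then have "|Field r| \<le>o |D|" using y card_of_ordLeq[of "Field r" D] by blast
  then have "r \<le>o |D|" using r ordIso_symmetric ordIso_ordLeq_trans by blast
  with 1 show ?thesis unfolding D(2) by (simp add: ordIso_iff_ordLeq)
qed

end

section \<open>Both scalar fields\<close>

lemma Auerbach_subspace_over:
  fixes sc :: "'k::real_normed_field \<Rightarrow> 'a::real_normed_vector \<Rightarrow> 'a" and \<kappa> :: "'c rel"
  assumes sc: "normed_space_over sc" and norming: "\<And>z. \<exists>f. norming sc f z"
    and \<kappa>: "Cinfinite \<kappa>" and K: "|UNIV :: 'k set| \<le>o \<kappa>"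
    and big: "ctwo ^c (ctwo ^c \<kappa>) <o dens (weak_star sc UNIV)"
  shows "\<exists>Y. closed_subspace sc Y \<and> has_Auerbach_basis sc Y \<and> dens (top_of_set Y) =o cardSuc \<kappa>"
proof -
  obtain N where N: "\<And>z. norming sc (N z) z" using norming by metis
  interpret vector_space sc using sc by (simp add: normed_space_over_def)
  interpret norming_selection sc N
    using sc N by unfold_locales (auto simp: normed_space_over_def)
  obtain u :: "'c set \<Rightarrow> 'a" and \<psi> where u:
    "\<And>i. i \<in> Field (cardSuc \<kappa>) \<Longrightarrow> norm (u i) = 1 \<and> norming sc (\<psi> i) (u i)"
    "\<And>i j. i \<in> Field (cardSuc \<kappa>) \<Longrightarrow> j \<in> Field (cardSuc \<kappa>) \<Longrightarrow> i \<noteq> j \<Longrightarrow> \<psi> i (u j) = 0"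
    "\<And>i z. i \<in> Field (cardSuc \<kappa>) \<Longrightarrow> z \<in> span (u ` underS (cardSuc \<kappa>) i) \<Longrightarrow> N z (u i) = 0"
    by (rule exists_monotone_Auerbach_system[OF \<kappa> K big]) (rule that)
  interpret monotone_Auerbach_system sc N "cardSuc \<kappa>" u \<psi>
    using u cardSuc_Well_order[of \<kappa>] \<kappa> by unfold_locales blast+
  have "dens (top_of_set Y) =o cardSuc \<kappa>"
  proof (rule dens_Y)
    show "Card_order (cardSuc \<kappa>)" using \<kappa> cardSuc_Card_order by blast
    show "infinite (Field (cardSuc \<kappa>))" using \<kappa> cardSuc_finite by (auto simp: cinfinite_def)
    show "|UNIV :: 'k set| \<le>o cardSuc \<kappa>" using K \<kappa> cardSuc_ordLeq ordLeq_transitive by blast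
  qed
  then show ?thesis using closed_subspace_Y has_Auerbach_basis_Y by blast
qed

lemma card_of_complex_ordLeq_real: "|UNIV :: complex set| \<le>o |UNIV :: real set|"
proof -
  have "|UNIV :: complex set| \<le>o |UNIV \<times> UNIV :: (real \<times> real) set|"
  proof (rule surj_imp_ordLeq, rule subsetI)
    show "z \<in> (\<lambda>(a, b). Complex a b) ` (UNIV \<times> UNIV)" for z
      by (intro image_eqI[of _ _ "(Re z, Im z)"]) auto
  qed
  also have "|UNIV \<times> UNIV :: (real \<times> real) set| =o |UNIV :: real set|"
    by (rule card_of_Times_same_infinite) (rule infinite_UNIV_char_0)
  finally show ?thesis .
qed

theorem theorem3p1:
  fixes \<kappa> :: "'c rel"
  assumes "Card_order \<kappa>"
    and "|UNIV :: real set| \<le>o \<kappa>"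
  shows "(\<forall>sc :: real \<Rightarrow> 'a::banach \<Rightarrow> 'a.
            normed_space_over sc \<longrightarrow>
            ctwo ^c (ctwo ^c \<kappa>) <o dens (weak_star sc UNIV) \<longrightarrow>
            (\<exists>Y. closed_subspace sc Y \<and> has_Auerbach_basis sc Y \<and>
                 dens (top_of_set Y) =o cardSuc \<kappa>))
       \<and> (\<forall>sc :: complex \<Rightarrow> 'a \<Rightarrow> 'a.
            normed_space_over sc \<longrightarrow>
            ctwo ^c (ctwo ^c \<kappa>) <o dens (weak_star sc UNIV) \<longrightarrow>
            (\<exists>Y. closed_subspace sc Y \<and> has_Auerbach_basis sc Y \<and>
                 dens (top_of_set Y) =o cardSuc \<kappa>))"
proof -
  have "infinite (Field \<kappa>)"
    using card_of_mono2[OF assms(2)] card_of_ordLeq_infinite infinite_UNIV_char_0[where 'a = real]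
    by (auto simp: Field_card_of)
  then have \<kappa>: "Cinfinite \<kappa>" using assms(1) by (simp add: cinfinite_def)
  have complex: "|UNIV :: complex set| \<le>o \<kappa>"
    using card_of_complex_ordLeq_real assms(2) ordLeq_transitive by blast
  show ?thesis
  proof (intro conjI allI impI)
    fix sc :: "real \<Rightarrow> 'a \<Rightarrow> 'a"
    assume sc: "normed_space_over sc" and big: "ctwo ^c (ctwo ^c \<kappa>) <o dens (weak_star sc UNIV)"
    have "\<exists>f. norming sc f z" for z
      using sc exists_norming_real by (simp add: normed_space_over_real_iff)
    then show "\<exists>Y. closed_subspace sc Y \<and> has_Auerbach_basis sc Y \<and>
        dens (top_of_set Y) =o cardSuc \<kappa>"
      by (rule Auerbach_subspace_over[OF sc _ \<kappa> assms(2) big])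
  next
    fix sc :: "complex \<Rightarrow> 'a \<Rightarrow> 'a"
    assume sc: "normed_space_over sc" and big: "ctwo ^c (ctwo ^c \<kappa>) <o dens (weak_star sc UNIV)"
    show "\<exists>Y. closed_subspace sc Y \<and> has_Auerbach_basis sc Y \<and>
        dens (top_of_set Y) =o cardSuc \<kappa>"
      by (rule Auerbach_subspace_over[OF sc exists_norming_complex[OF sc] \<kappa> complex big])
  qed
qed

end
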